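(* Assume that the output map lies in the span of the principal Koopman eigenfunctions, i.e. there is a matrix $C\in\mathbb{R}^{p\times n}$ with $h(x)=C\Phi(x)$ for all $x\in\mathbb{R}^n$. Then the optimal value function $\mathcal{V}(x,t)$, solution of the Hamilton--Jacobi equation $$\frac{\partial \mathcal V}{\partial t}+\frac{\partial \mathcal V}{\partial x}f(x)+\frac12\frac{\partial \mathcal V}{\partial x}R_1(x)^{-1}\Big(\frac{\partial \mathcal V}{\partial x}\Big)^{\top}-\frac12\,(y(t)-h(x))^\top Q^{-1}(y(t)-h(x))=0$$ with initial condition $\mathcal V(x,0)=\frac12(\Phi(x)-\Phi(\mu))^\top\Sigma^{-1}(\Phi(x)-\Phi(\mu))$, is given for $x\in\mathbb{R}^n$, $t\in[0,T]$ by $$\mathcal V(x,t)=\mathcal V_\Phi(x,t):=\frac12\Phi(x)^\top P(t)\Phi(x)+s(t)^\top\Phi(x)+r(t),$$ where $P(t)\in\mathbb{R}^{n\times n}$ is a positive (definite) matrix, and $P(t)$, $s(t)\in\mathbb{R}^n$ and $r(t)\in\mathbb{R}$ satisfy, for $t\in[0,T]$, $$\dot P(t)+\Lambda^\top P(t)+P(t)\Lambda+P(t)RP(t)-C^\top Q^{-1}C=0,$$ $$\dot s(t)+\Lambda^\top s(t)+P(t)Rs(t)+C^\top Q^{-1}y(t)=0,$$ $$\dot r(t)+\frac12 s(t)^\top R\,s(t)-\frac12 y(t)^\top Q^{-1}y(t)=0,$$ with initial conditions $P(0)=\Sigma^{-1}$, $s(0)=-\Sigma^{-1}\Phi(\mu)$,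 $r(0)=\frac12\Phi(\mu)^\top\Sigma^{-1}\Phi(\mu)$.
   Context: Setting: $f:\mathbb{R}^n\to\mathbb{R}^n$ and $h:\mathbb{R}^n\to\mathbb{R}^p$ are smooth; the origin is a hyperbolic equilibrium of $\dot x=f(x)$; $R\in\mathbb{R}^{n\times n}$, $Q\in\mathbb{R}^{p\times p}$, $\Sigma\in\mathbb{R}^{n\times n}$ are (symmetric positive definite) covariance matrices; $\mu\in\mathbb{R}^n$; $T>0$; $y:[0,T]\to\mathbb{R}^p$ is the given measurement signal. Principal Koopman eigenfunctions: $\Phi=(\phi_1,\dots,\phi_n)^\top:\mathbb{R}^n\to\mathbb{R}^n$ is a (at least $C^1$) real vector of functions defined on all of $\mathbb{R}^n$ with $\frac{\partial\Phi}{\partial x}(x)f(x)=\Lambda\Phi(x)$ for all $x$, where $\Lambda\in\mathbb{R}^{n\times n}$ is in real Jordan canonical form and its eigenvalues are those of the linearization $A=\frac{\partial f}{\partial x}(0)$. $\Phi$ is a change of coordinates transforming the nonlinear system to a linear one; in particular $\frac{\partial\Phi}{\partial x}(x)$ is invertible for every $x$. $R_1(x):=\frac{\partial\Phi}{\partial x}(x)^\top R^{-1}\frac{\partial\Phi}{\partial x}(x)$. Optimal value function: for $0\le t\le T$, $\mathcal V(x,t)=\min_{u(\tau),\,0\le\tau\le t}\mathcal J_t[u]$, where $$\mathcal J_t[u]=\frac12(\Phi(x(0))-\Phi(\mu))^\top\Sigma^{-1}(\Phi(x(0))-\Phi(\mu))+\frac12\int_0^t\Big[u(\tau)^\top R_1(x(\tau))u(\tau)+(y(\tau)-h(x(\tau)))^\top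 Q^{-1}(y(\tau)-h(x(\tau)))\Big]d\tau,$$ subject to $\dot x(\tau)=f(x(\tau))+u(\tau)$, $x(t)=x$, with $x(0)$ free. It is the (viscosity) solution of the Hamilton--Jacobi equation in the claim with the stated initial condition.
   Formalization: The measurement signal y is assumed continuous on [0,T], and the change of coordinates Φ is assumed to be a bijection of R^n onto R^n; without these the coefficient equations can fail at some t, or the minimum need not be attained and can exceed V_Φ. *)

theory Defs
  imports "HOL-Analysis.Analysis"
begin

section \<open>Regularity and matrices\<close>

text \<open>On Euclidean spaces, \<open>C_k k f\<close> says that \<open>f\<close> is \<open>k\<close> times continuously differentiable
  everywhere: all directional derivatives are again \<open>k - 1\<close> times continuously differentiable.\<close>

primrec C_k :: "nat \<Rightarrow> ('a::euclidean_space \<Rightarrow> 'b::euclidean_space) \<Rightarrow> bool" where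
  "C_k 0 f \<longleftrightarrow> continuous_on UNIV f"
| "C_k (Suc k) f \<longleftrightarrow> (\<forall>x. f differentiable (at x)) \<and>
     (\<forall>v. C_k k (\<lambda>x. frechet_derivative f (at x) v))"

definition smooth :: "('a::euclidean_space \<Rightarrow> 'b::euclidean_space) \<Rightarrow> bool" where
  "smooth f \<longleftrightarrow> (\<forall>k. C_k k f)"

definition quad_form :: "real^'n^'n \<Rightarrow> real^'n \<Rightarrow> real" where
  "quad_form A v = v \<bullet> (A *v v)"

definition pos_def :: "real^'n^'n \<Rightarrow> bool" where
  "pos_def A \<longleftrightarrow> transpose A = A \<and> (\<forall>v. v \<noteq> 0 \<longrightarrow> 0 < quad_form A v)"

definition eigenvalues :: "real^'n^'n \<Rightarrow> complex set" where
  "eigenvalues A = {z. \<exists>v::complex^'n. v \<noteq> 0 \<and> (\<chi> i j. complex_of_real (A $ i $ j)) *v v = z *s v}"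

definition hyperbolic_equilibrium :: "(real^'n \<Rightarrow> real^'n) \<Rightarrow> real^'n \<Rightarrow> bool" where
  "hyperbolic_equilibrium f x \<longleftrightarrow> f x = 0 \<and> (\<forall>z \<in> eigenvalues (jacobian f (at x)). Re z \<noteq> 0)"


section \<open>Real Jordan canonical form\<close>

text \<open>\<open>Real_Block k a\<close> is the \<open>k \<times> k\<close> Jordan block of the real eigenvalue \<open>a\<close>.
  \<open>Complex_Block k a b\<close> is the \<open>2k \<times> 2k\<close> real block of the pair of complex eigenvalues \<open>a \<plusminus> ib\<close>:
  it has \<open>k\<close> diagonal blocks with rows \<open>(a, b)\<close> and \<open>(-b, a)\<close>, and \<open>2 \<times> 2\<close> identity matrices
  above them. Both signs of \<open>b\<close> are allowed, which covers both usual sign conventions.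
  Indices start from \<open>0\<close>.\<close>

datatype jordan_block = Real_Block nat real | Complex_Block nat real real

fun block_wf :: "jordan_block \<Rightarrow> bool" where
  "block_wf (Real_Block k a) \<longleftrightarrow> k > 0"
| "block_wf (Complex_Block k a b) \<longleftrightarrow> k > 0 \<and> b \<noteq> 0"

fun block_size :: "jordan_block \<Rightarrow> nat" where
  "block_size (Real_Block k a) = k"
| "block_size (Complex_Block k a b) = 2 * k"

fun block_entry :: "jordan_block \<Rightarrow> nat \<Rightarrow> nat \<Rightarrow> real" where
  "block_entry (Real_Block k a) i j = (if i = j then a else if j = Suc i then 1 else 0)"
| "block_entry (Complex_Block k a b) i j =
     (if i div 2 = j div 2 then (if i = j then a else if i < j then b else - b)
      else if j = i + 2 then 1 else 0)"

fun block_diag_entry :: "jordan_block list \<Rightarrow> nat \<Rightarrow> nat \<Rightarrow> real" where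
  "block_diag_entry [] i j = 0"
| "block_diag_entry (B # Bs) i j =
     (let m = block_size B in
      if i < m \<and> j < m then block_entry B i j
      else if m \<le> i \<and> m \<le> j then block_diag_entry Bs (i - m) (j - m)
      else 0)"

text \<open>A finite index type carries no canonical order, so the form is required with respect to
  some enumeration \<open>e\<close> of the indices.\<close>

definition real_jordan_form :: "real^'n^'n \<Rightarrow> bool" where
  "real_jordan_form A \<longleftrightarrow>
     (\<exists>Bs e. (\<forall>B \<in> set Bs. block_wf B) \<and> sum_list (map block_size Bs) = CARD('n) \<and>
        bij_betw e (UNIV :: 'n set) {..<CARD('n)} \<and>
        (\<forall>i j. A $ i $ j = block_diag_entry Bs (e i) (e j)))"


section \<open>Principal Koopman eigenfunctions\<close>

text \<open>\<open>\<Phi>\<close> is a global change of coordinates of \<open>\<real>\<^sup>n\<close>: a \<open>C\<^sup>1\<close> bijection with everywhere invertible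
  Jacobian, hence a \<open>C\<^sup>1\<close> diffeomorphism of \<open>\<real>\<^sup>n\<close> onto \<open>\<real>\<^sup>n\<close>. Surjectivity matters: for
  \<open>f x = - x (1 + x\<^sup>2)\<close> and \<open>\<Phi> x = x / sqrt (1 + x\<^sup>2)\<close>, with image \<open>(-1, 1)\<close>, the minimum
  defining the optimal value need not be attained.\<close>

definition principal_eigenfunctions ::
    "(real^'n \<Rightarrow> real^'n) \<Rightarrow> real^'n^'n \<Rightarrow> (real^'n \<Rightarrow> real^'n) \<Rightarrow> bool" where
  "principal_eigenfunctions f \<Lambda> \<Phi> \<longleftrightarrow>
     C_k 1 \<Phi> \<and> bij \<Phi> \<and> (\<forall>x. invertible (jacobian \<Phi> (at x))) \<and>
     real_jordan_form \<Lambda> \<and> eigenvalues \<Lambda> = eigenvalues (jacobian f (at 0)) \<and>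
     (\<forall>x. jacobian \<Phi> (at x) *v f x = \<Lambda> *v \<Phi> x)"

definition R1 :: "(real^'n \<Rightarrow> real^'n) \<Rightarrow> real^'n^'n \<Rightarrow> real^'n \<Rightarrow> real^'n^'n" where
  "R1 \<Phi> R x = transpose (jacobian \<Phi> (at x)) ** matrix_inv R ** jacobian \<Phi> (at x)"


section \<open>Optimal value function\<close>

text \<open>Controls \<open>u\<close> are square integrable on \<open>[0, t]\<close>; the state equation \<open>x' = f x + u\<close> holds in
  the sense of Caratheodory, that is, in integrated form. The end point is prescribed and the
  initial point is free.\<close>

definition admissible ::
    "(real^'n \<Rightarrow> real^'n) \<Rightarrow> real^'n \<Rightarrow> real \<Rightarrow> (real \<Rightarrow> real^'n) \<Rightarrow> (real \<Rightarrow> real^'n) \<Rightarrow> bool" where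
  "admissible f x t \<xi> u \<longleftrightarrow>
     u absolutely_integrable_on {0..t} \<and>
     (\<lambda>\<tau>. (norm (u \<tau>))\<^sup>2) absolutely_integrable_on {0..t} \<and>
     (\<forall>\<tau>\<in>{0..t}. ((\<lambda>\<sigma>. f (\<xi> \<sigma>) + u \<sigma>) has_integral (\<xi> \<tau> - \<xi> 0)) {0..\<tau>}) \<and>
     \<xi> t = x"

definition initial_cost ::
    "(real^'n \<Rightarrow> real^'n) \<Rightarrow> real^'n^'n \<Rightarrow> real^'n \<Rightarrow> real^'n \<Rightarrow> real" where
  "initial_cost \<Phi> \<Sigma> \<mu> x = 1/2 * quad_form (matrix_inv \<Sigma>) (\<Phi> x - \<Phi> \<mu>)"

definition cost ::
    "(real^'n \<Rightarrow> real^'p) \<Rightarrow> (real^'n \<Rightarrow> real^'n) \<Rightarrow> real^'n^'n \<Rightarrow> real^'p^'p \<Rightarrow> real^'n^'n \<Rightarrow> real^'n \<Rightarrow>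
     (real \<Rightarrow> real^'p) \<Rightarrow> real \<Rightarrow> (real \<Rightarrow> real^'n) \<Rightarrow> (real \<Rightarrow> real^'n) \<Rightarrow> real" where
  "cost h \<Phi> R Q \<Sigma> \<mu> y t \<xi> u =
     initial_cost \<Phi> \<Sigma> \<mu> (\<xi> 0) +
     1/2 * integral {0..t}
       (\<lambda>\<tau>. quad_form (R1 \<Phi> R (\<xi> \<tau>)) (u \<tau>) + quad_form (matrix_inv Q) (y \<tau> - h (\<xi> \<tau>)))"

definition costs ::
    "(real^'n \<Rightarrow> real^'n) \<Rightarrow> (real^'n \<Rightarrow> real^'p) \<Rightarrow> (real^'n \<Rightarrow> real^'n) \<Rightarrow>
     real^'n^'n \<Rightarrow> real^'p^'p \<Rightarrow> real^'n^'n \<Rightarrow> real^'n \<Rightarrow>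
     (real \<Rightarrow> real^'p) \<Rightarrow> real^'n \<Rightarrow> real \<Rightarrow> real set" where
  "costs f h \<Phi> R Q \<Sigma> \<mu> y x t = {cost h \<Phi> R Q \<Sigma> \<mu> y t \<xi> u |\<xi> u. admissible f x t \<xi> u}"

text \<open>The infimum is a minimum when it belongs to \<open>costs\<close>, since for positive definite weights
  the costs are bounded below by \<open>0\<close>.\<close>

definition optimal_value ::
    "(real^'n \<Rightarrow> real^'n) \<Rightarrow> (real^'n \<Rightarrow> real^'p) \<Rightarrow> (real^'n \<Rightarrow> real^'n) \<Rightarrow>
     real^'n^'n \<Rightarrow> real^'p^'p \<Rightarrow> real^'n^'n \<Rightarrow> real^'n \<Rightarrow>
     (real \<Rightarrow> real^'p) \<Rightarrow> real^'n \<Rightarrow> real \<Rightarrow> real" where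
  "optimal_value f h \<Phi> R Q \<Sigma> \<mu> y x t = Inf (costs f h \<Phi> R Q \<Sigma> \<mu> y x t)"


section \<open>Hamilton--Jacobi equation\<close>

text \<open>A classical (continuously differentiable) solution on \<open>\<real>\<^sup>n \<times> [0, T]\<close>, with one-sided time
  derivatives at \<open>0\<close> and \<open>T\<close>; \<open>Vt\<close> is the time derivative and \<open>Vx\<close> the spatial gradient.\<close>

definition HJ_solution ::
    "(real^'n \<Rightarrow> real^'n) \<Rightarrow> (real^'n \<Rightarrow> real^'p) \<Rightarrow> (real^'n \<Rightarrow> real^'n) \<Rightarrow>
     real^'n^'n \<Rightarrow> real^'p^'p \<Rightarrow> (real \<Rightarrow> real^'p) \<Rightarrow> real \<Rightarrow> (real^'n \<Rightarrow> real \<Rightarrow> real) \<Rightarrow> bool" where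
  "HJ_solution f h \<Phi> R Q y T V \<longleftrightarrow>
     (\<exists>Vt Vx. continuous_on (UNIV \<times> {0..T}) (\<lambda>(x, t). Vt x t) \<and>
        continuous_on (UNIV \<times> {0..T}) (\<lambda>(x, t). Vx x t) \<and>
        (\<forall>x. \<forall>t\<in>{0..T}.
           ((\<lambda>\<tau>. V x \<tau>) has_real_derivative Vt x t) (at t within {0..T}) \<and>
           ((\<lambda>\<xi>. V \<xi> t) has_derivative (\<lambda>v. Vx x t \<bullet> v)) (at x) \<and>
           Vt x t + Vx x t \<bullet> f x + 1/2 * quad_form (matrix_inv (R1 \<Phi> R x)) (Vx x t)
             - 1/2 * quad_form (matrix_inv Q) (y t - h x) = 0))"


section \<open>Coefficient equations\<close>

definition coefficient_solution ::
    "real^'n^'n \<Rightarrow> real^'n^'p \<Rightarrow> (real^'n \<Rightarrow> real^'n) \<Rightarrow> real^'n^'n \<Rightarrow> real^'p^'p \<Rightarrow> real^'n^'n \<Rightarrow> real^'n \<Rightarrow>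
     (real \<Rightarrow> real^'p) \<Rightarrow> real \<Rightarrow>
     (real \<Rightarrow> real^'n^'n) \<Rightarrow> (real \<Rightarrow> real^'n) \<Rightarrow> (real \<Rightarrow> real) \<Rightarrow> bool" where
  "coefficient_solution \<Lambda> C \<Phi> R Q \<Sigma> \<mu> y T P s r \<longleftrightarrow>
     (\<exists>P' s' r'. \<forall>t\<in>{0..T}.
        (P has_vector_derivative P' t) (at t within {0..T}) \<and>
        (s has_vector_derivative s' t) (at t within {0..T}) \<and>
        (r has_real_derivative r' t) (at t within {0..T}) \<and>
        P' t + transpose \<Lambda> ** P t + P t ** \<Lambda> + P t ** R ** P t
          - transpose C ** matrix_inv Q ** C = 0 \<and>
        s' t + transpose \<Lambda> *v s t + (P t ** R) *v s t + (transpose C ** matrix_inv Q) *v y t = 0 \<and>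
        r' t + 1/2 * quad_form R (s t) - 1/2 * quad_form (matrix_inv Q) (y t) = 0) \<and>
     P 0 = matrix_inv \<Sigma> \<and>
     s 0 = - (matrix_inv \<Sigma> *v \<Phi> \<mu>) \<and>
     r 0 = 1/2 * quad_form (matrix_inv \<Sigma>) (\<Phi> \<mu>)"

definition V_Phi ::
    "(real^'n \<Rightarrow> real^'n) \<Rightarrow> (real \<Rightarrow> real^'n^'n) \<Rightarrow> (real \<Rightarrow> real^'n) \<Rightarrow> (real \<Rightarrow> real) \<Rightarrow>
     real^'n \<Rightarrow> real \<Rightarrow> real" where
  "V_Phi \<Phi> P s r x t = 1/2 * quad_form (P t) (\<Phi> x) + s t \<bullet> \<Phi> x + r t"

end

theory Submission
  imports Defs
begin

text \<open>In the coordinates \<open>z = \<Phi> x\<close> the state equation \<open>x' = f x + u\<close> becomes the linear equation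
  \<open>z' = \<Lambda> z + v\<close> with \<open>v = D\<Phi>(x) u\<close>; the weight \<open>R1\<close> is chosen so that the control is charged
  \<open>v \<bullet> R\<^sup>-\<^sup>1 v\<close>, and the output \<open>C z\<close> is linear as well. The minimum energy estimation problem is therefore
  a linear-quadratic one in disguise, and its value function is quadratic in \<open>z\<close>.

  The coefficients exist on all of \<open>[0, T]\<close> because the Riccati equation is linearized by
  \<open>P = Y X\<^sup>-\<^sup>1\<close>, where \<open>(X, Y)\<close> solves the linear Hamiltonian system. For \<open>v \<noteq> 0\<close> the quantity \<open>(X v) \<bullet> (Y v)\<close> starts
  positive and has a nonnegative derivative, so \<open>X\<close> never becomes singular and \<open>P\<close> stays positive
  definite (\<open>riccati_solution_exists\<close>). Uniqueness transfers positive definiteness to every solution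
  (\<open>riccati_solution_unique\<close>). The equations for \<open>s\<close> and \<open>r\<close> are then a linear equation and a quadrature.

  Substituting \<open>V_Phi\<close> into the Hamilton--Jacobi equation and comparing the terms of degree two, one and
  zero in \<open>z\<close> gives exactly the three coefficient equations (\<open>koopman_hamilton_jacobi\<close>). Optimality is a
  verification argument: along an admissible trajectory the derivative of a classical solution \<open>V\<close> of the
  Hamilton--Jacobi equation equals half the running cost minus half the square of the deviation of \<open>u\<close>
  from the feedback \<open>R1\<^sup>-\<^sup>1 \<nabla>V\<close> (\<open>completion_of_squares_along_trajectory\<close>). So every cost is at least the
  value of \<open>V\<close> at the prescribed end point, with equality for the feedback. The closed loop is a linear
  equation in \<open>z\<close>, solved backwards from the end point and pulled back by \<open>\<Phi>\<^sup>-\<^sup>1\<close>, which is where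
  surjectivity of \<open>\<Phi>\<close> is used (\<open>feedback_trajectory_exists\<close>).

  Trajectories with square integrable controls need not be differentiable at any prescribed time. The
  chain rule for them is proved in integrated form, from uniform estimates of increments over short time
  intervals (\<open>caratheodory_chain_rule\<close>), without differentiating the trajectory.\<close>

section \<open>Matrix calculus\<close>

lemma inner_matrix_vector_transpose:
  fixes A :: "real^'n^'m"
  shows "x \<bullet> (A *v y) = (transpose A *v x) \<bullet> y"
  by (simp add: dot_lmul_matrix[symmetric])

lemma bounded_bilinear_matrix_mult:
  "bounded_bilinear ((**) :: real^'n^'m \<Rightarrow> real^'k^'n \<Rightarrow> real^'k^'m)"
  unfolding bilinear_conv_bounded_bilinear[symmetric] bilinear_def
  by (auto intro!: linearI simp: matrix_matrix_mult_def vec_eq_iff algebra_simps sum.distrib sum_distrib_left)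

lemma bounded_bilinear_matrix_vector_mult:
  "bounded_bilinear ((*v) :: real^'n^'m \<Rightarrow> real^'n \<Rightarrow> real^'m)"
  unfolding bilinear_conv_bounded_bilinear[symmetric] bilinear_def
  by (auto intro!: linearI
      simp: matrix_vector_right_distrib matrix_vector_mult_add_rdistrib
        scaleR_matrix_vector_assoc matrix_vector_mult_scaleR)

interpretation mm: bounded_bilinear "(**) :: real^'n^'m \<Rightarrow> real^'k^'n \<Rightarrow> real^'k^'m"
  by (rule bounded_bilinear_matrix_mult)

interpretation mv: bounded_bilinear "(*v) :: real^'n^'m \<Rightarrow> real^'n \<Rightarrow> real^'m"
  by (rule bounded_bilinear_matrix_vector_mult)

lemma bounded_linear_transpose:
  "bounded_linear (transpose :: real^'n^'m \<Rightarrow> real^'m^'n)"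
  by (auto intro!: linear_conv_bounded_linear[THEN iffD1] linearI simp: transpose_def vec_eq_iff)

lemmas transpose_simps = linear_simps[OF bounded_linear_transpose]

lemma matrix_inv_inverse:
  fixes A :: "real^'n^'n"
  assumes "invertible A"
  shows "A ** matrix_inv A = mat 1" "matrix_inv A ** A = mat 1"
  using assms unfolding invertible_def matrix_inv_def by (metis (mono_tags, lifting) someI_ex)+

lemma matrix_inv_inverse_vector:
  fixes A :: "real^'n^'n"
  assumes "invertible A"
  shows "A *v (matrix_inv A *v v) = v" "matrix_inv A *v (A *v v) = v"
  using matrix_inv_inverse[OF assms] by (simp_all add: matrix_vector_mul_assoc)

lemma matrix_inv_unique:
  fixes A B :: "real^'n^'n"
  assumes "A ** B = mat 1"
  shows "matrix_inv A = B"
  by (metis assms invertible_right_inverse matrix_inv_inverse(2) matrix_mul_assoc matrix_mul_lid matrix_mul_rid)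

lemma invertible_if_kernel_trivial:
  fixes A :: "real^'n^'n"
  assumes "\<And>v. A *v v = 0 \<Longrightarrow> v = 0"
  shows "invertible A"
  using assms invertible_left_inverse matrix_left_invertible_ker by blast

lemma pos_def_invertible: "pos_def A \<Longrightarrow> invertible A"
  by (rule invertible_if_kernel_trivial) (auto simp: pos_def_def quad_form_def)

lemma quad_form_nonneg: "pos_def A \<Longrightarrow> 0 \<le> quad_form A v"
  unfolding pos_def_def by (cases "v = 0") (auto simp: quad_form_def less_imp_le)

lemma matrix_inv_symmetric:
  fixes A :: "real^'n^'n"
  assumes "invertible A" "transpose A = A"
  shows "transpose (matrix_inv A) = matrix_inv A"
  by (metis assms matrix_inv_inverse(2) matrix_inv_unique matrix_transpose_mul transpose_mat)

lemma pos_def_matrix_inv: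
  assumes "pos_def A"
  shows "pos_def (matrix_inv A)"
  unfolding pos_def_def
proof (intro conjI allI impI)
  have inv: "invertible A" using assms by (rule pos_def_invertible)
  show "transpose (matrix_inv A) = matrix_inv A"
    using assms inv by (auto simp: pos_def_def intro: matrix_inv_symmetric)
  fix v :: "real^'a" assume "v \<noteq> 0"
  let ?w = "matrix_inv A *v v"
  have v: "v = A *v ?w" using inv by (simp add: matrix_inv_inverse_vector)
  with \<open>v \<noteq> 0\<close> have "?w \<noteq> 0" by auto
  with assms have "0 < quad_form A ?w" by (auto simp: pos_def_def)
  also have "quad_form A ?w = quad_form (matrix_inv A) v"
    using v by (simp add: quad_form_def inner_commute)
  finally show "0 < quad_form (matrix_inv A) v" .
qed

lemma pos_def_congruence:
  fixes A B :: "real^'n^'n"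
  assumes "pos_def A" "invertible B"
  shows "pos_def (transpose B ** A ** B)"
  unfolding pos_def_def
proof (intro conjI allI impI)
  show "transpose (transpose B ** A ** B) = transpose B ** A ** B"
    using assms(1) by (simp add: pos_def_def matrix_transpose_mul matrix_mul_assoc)
  fix v :: "real^'n" assume "v \<noteq> 0"
  then have "B *v v \<noteq> 0"
    by (metis assms(2) matrix_inv_inverse_vector(2) mv.zero_right)
  then have "0 < quad_form A (B *v v)" using assms(1) by (auto simp: pos_def_def)
  then show "0 < quad_form (transpose B ** A ** B) v"
    by (simp add: quad_form_def inner_matrix_vector_transpose[of v "transpose B"]
        matrix_vector_mul_assoc[symmetric] del: transpose_matrix_vector)
qed

lemma quad_form_diff:
  assumes "transpose A = A"
  shows "quad_form A (v - w) = quad_form A v - 2 * (v \<bullet> (A *v w)) + quad_form A w"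
  using inner_matrix_vector_transpose[of w A v] assms
  by (simp add: quad_form_def mv.diff_right inner_diff_left inner_diff_right inner_commute)

lemma output_weight_psd:
  fixes C :: "real^'n^'p"
  assumes "pos_def Q"
  shows "0 \<le> quad_form (transpose C ** matrix_inv Q ** C) v"
    and "transpose (transpose C ** matrix_inv Q ** C) = transpose C ** matrix_inv Q ** C"
proof -
  have Qi: "pos_def (matrix_inv Q)" using assms by (rule pos_def_matrix_inv)
  have "quad_form (transpose C ** matrix_inv Q ** C) v = quad_form (matrix_inv Q) (C *v v)"
    by (simp add: quad_form_def inner_matrix_vector_transpose[of v "transpose C"]
        matrix_vector_mul_assoc[symmetric] del: transpose_matrix_vector)
  then show "0 \<le> quad_form (transpose C ** matrix_inv Q ** C) v"
    using quad_form_nonneg[OF Qi] by simp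
  show "transpose (transpose C ** matrix_inv Q ** C) = transpose C ** matrix_inv Q ** C"
    using Qi by (simp add: pos_def_def matrix_transpose_mul matrix_mul_assoc)
qed

lemma continuous_on_quad_form:
  assumes "continuous_on S A" "continuous_on S v"
  shows "continuous_on S (\<lambda>x. quad_form (A x) (v x))"
  unfolding quad_form_def using assms by (intro continuous_intros mv.continuous_on)

text \<open>By Cramer's rule the entries of the inverse are quotients of determinants, which are polynomials in the
  entries of the matrix.\<close>

lemma continuous_on_matrix_inv:
  fixes A :: "'a::topological_space \<Rightarrow> real^'n^'n"
  assumes cont: "continuous_on S A" and inv: "\<And>x. x \<in> S \<Longrightarrow> invertible (A x)"
  shows "continuous_on S (\<lambda>x. matrix_inv (A x))"
proof -
  \<comment> \<open>\<open>B x i j\<close> is \<open>A x\<close> with column \<open>i\<close> replaced by the \<open>j\<close>-th unit vector.\<close>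
  define B where "B x i j = (\<chi> k l. if l = i then (axis j 1 :: real^'n) $ k else A x $ k $ l)" for x i j
  have det: "det (A x) \<noteq> 0" if "x \<in> S" for x
    using inv[OF that] by (simp add: invertible_det_nz)
  have "matrix_inv (A x) = (\<chi> i j. det (B x i j) / det (A x))" if "x \<in> S" for x
  proof -
    have "matrix_inv (A x) *v axis j 1 = (\<chi> i. det (B x i j) / det (A x))" for j
      unfolding B_def
      using cramer[OF det[OF that], of "matrix_inv (A x) *v axis j 1" "axis j 1"]
      by (simp add: matrix_inv_inverse_vector inv that)
    then have "matrix_inv (A x) $ i $ j = det (B x i j) / det (A x)" for i j
      by (metis matrix_vector_mult_basis column_def vec_lambda_beta)
    then show ?thesis by (simp add: vec_eq_iff)
  qed
  moreover have "continuous_on S (\<lambda>x. det (M x))"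
    if "\<And>k l. continuous_on S (\<lambda>x. M x $ k $ l)" for M :: "'a \<Rightarrow> real^'n^'n"
    unfolding det_def using that by (intro continuous_on_sum continuous_on_mult continuous_on_const continuous_on_prod) auto
  moreover have entries: "continuous_on S (\<lambda>x. A x $ k $ l)" for k l
    using cont by (intro continuous_intros)
  moreover have "continuous_on S (\<lambda>x. B x i j $ k $ l)" for i j k l
    unfolding B_def using entries by (cases "l = i") (simp_all add: continuous_intros)
  ultimately show ?thesis
    using det by (auto intro!: continuous_intros cong: continuous_on_cong)
qed

lemma has_vector_derivative_iff_quotient:
  "(f has_vector_derivative f') (at t within S) \<longleftrightarrow>
    ((\<lambda>s. (1 / (s - t)) *\<^sub>R (f s - f t)) \<longlongrightarrow> f') (at t within S)"
proof -
  have "norm ((1 / norm (s - t)) *\<^sub>R (f s - (f t + (s - t) *\<^sub>R f')))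
      = norm ((1 / (s - t)) *\<^sub>R (f s - f t) - f')" if "s \<noteq> t" for s
  proof -
    have "(1 / (s - t)) *\<^sub>R (f s - f t) - f' = (1 / (s - t)) *\<^sub>R (f s - (f t + (s - t) *\<^sub>R f'))"
      using that by (simp add: scaleR_diff_right scaleR_add_right)
    then show ?thesis by simp
  qed
  then have "((\<lambda>s. norm ((1 / norm (s - t)) *\<^sub>R (f s - (f t + (s - t) *\<^sub>R f')))) \<longlongrightarrow> 0) (at t within S)
    \<longleftrightarrow> ((\<lambda>s. norm ((1 / (s - t)) *\<^sub>R (f s - f t) - f')) \<longlongrightarrow> 0) (at t within S)"
    by (intro Lim_cong_within) auto
  then show ?thesis
    unfolding tendsto_norm_zero_iff LIM_zero_iff
    by (simp add: has_vector_derivative_def has_derivative_within bounded_linear_scaleR_left)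
qed

text \<open>The identity \<open>B s - B t = - B s (A s - A t) B t\<close> for \<open>B = A\<^sup>-\<^sup>1\<close> turns continuity of the inverse into
  differentiability.\<close>

lemma has_vector_derivative_matrix_inv:
  fixes A :: "real \<Rightarrow> real^'n^'n"
  assumes A: "(A has_vector_derivative A') (at t within S)"
    and inv: "\<And>s. s \<in> S \<Longrightarrow> invertible (A s)" and "t \<in> S" and cont: "continuous_on S A"
  shows "((\<lambda>s. matrix_inv (A s)) has_vector_derivative
    - (matrix_inv (A t) ** A' ** matrix_inv (A t))) (at t within S)"
proof -
  let ?B = "\<lambda>s. matrix_inv (A s)"
  have diff: "?B s - ?B t = - (?B s ** (A s - A t) ** ?B t)" if "s \<in> S" for s
    using matrix_inv_inverse[OF inv[OF that]] matrix_inv_inverse[OF inv[OF \<open>t \<in> S\<close>]]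
    by (simp add: mm.diff_left mm.diff_right matrix_mul_assoc[symmetric])
  have lim: "((\<lambda>s. (1 / (s - t)) *\<^sub>R (A s - A t)) \<longlongrightarrow> A') (at t within S)"
    using A by (simp add: has_vector_derivative_iff_quotient)
  have B: "(?B \<longlongrightarrow> ?B t) (at t within S)"
    using continuous_on_matrix_inv[OF cont inv] \<open>t \<in> S\<close> by (auto simp: continuous_on)
  have "((\<lambda>s. - (?B s ** ((1 / (s - t)) *\<^sub>R (A s - A t)) ** ?B t)) \<longlongrightarrow> - (?B t ** A' ** ?B t))
      (at t within S)"
    by (intro tendsto_minus mm.tendsto B lim tendsto_const)
  then have "((\<lambda>s. (1 / (s - t)) *\<^sub>R (?B s - ?B t)) \<longlongrightarrow> - (?B t ** A' ** ?B t)) (at t within S)"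
    by (rule Lim_transform_eventually)
      (auto simp: eventually_at_filter diff mm.scaleR_left mm.scaleR_right)
  then show ?thesis by (simp add: has_vector_derivative_iff_quotient)
qed

section \<open>Linear differential equations\<close>

lemma nondecreasing_if_derivative_nonneg:
  fixes f :: "real \<Rightarrow> real"
  assumes "a \<le> b"
    and "\<And>t. t \<in> {a..b} \<Longrightarrow> (f has_vector_derivative f' t) (at t within {a..b})"
    and "\<And>t. t \<in> {a..b} \<Longrightarrow> 0 \<le> f' t"
  shows "f a \<le> f b"
  using has_integral_nonneg[OF fundamental_theorem_of_calculus[OF assms(1,2)] assms(3)] by simp

lemma has_vector_derivative_subinterval:
  assumes "(f has_vector_derivative f') (at t within {a..T})" "b \<le> T"
  shows "(f has_vector_derivative f') (at t within {a..b::real})"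
  using assms(1) by (rule has_vector_derivative_within_subset) (use assms(2) in auto)

lemma continuous_on_if_has_vector_derivative:
  assumes "\<And>t. t \<in> S \<Longrightarrow> (f has_vector_derivative f' t) (at t within S)"
  shows "continuous_on S f"
  using assms by (auto simp: continuous_on_eq_continuous_within intro: has_vector_derivative_continuous)

lemma continuous_function_bounded:
  fixes P :: "real \<Rightarrow> 'a::real_normed_vector"
  assumes "continuous_on {0..T} P"
  obtains B where "\<And>t. t \<in> {0..T} \<Longrightarrow> norm (P t) \<le> B"
  using compact_imp_bounded[OF compact_continuous_image[OF assms compact_Icc]]
  unfolding bounded_iff by blast

text \<open>Gronwall's argument: \<open>exp (- 2 K t) |D t|\<^sup>2\<close> is nonincreasing.\<close>

lemma zero_if_derivative_bounded_by_norm: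
  fixes D :: "real \<Rightarrow> 'a::euclidean_space"
  assumes D: "\<And>t. t \<in> {0..T} \<Longrightarrow> (D has_vector_derivative D' t) (at t within {0..T})"
    and bound: "\<And>t. t \<in> {0..T} \<Longrightarrow> norm (D' t) \<le> K * norm (D t)"
    and "D 0 = 0" and t: "t \<in> {0..T}"
  shows "D t = 0"
proof -
  define w where "w s = - (exp (- 2 * K * s) * (D s \<bullet> D s))" for s
  have "w 0 \<le> w t"
  proof (rule nondecreasing_if_derivative_nonneg[where f = w])
    show "0 \<le> t" using t by simp
    fix s assume s: "s \<in> {0..t}"
    have D_s: "(D has_vector_derivative D' s) (at s within {0..t})"
      using D[of s] s t by (auto intro: has_vector_derivative_subinterval)
    have "((\<lambda>s. exp (- 2 * K * s)) has_vector_derivative - 2 * K * exp (- 2 * K * s)) (at s within {0..t})"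
      by (auto intro!: derivative_eq_intros simp: has_real_derivative_iff_has_vector_derivative[symmetric])
    from has_vector_derivative_minus[OF bounded_bilinear.has_vector_derivative[OF bounded_bilinear_mult
        this bounded_bilinear.has_vector_derivative[OF bounded_bilinear_inner D_s D_s]]]
    show "(w has_vector_derivative exp (- 2 * K * s) * (2 * (K * (D s \<bullet> D s) - D s \<bullet> D' s)))
        (at s within {0..t})"
      unfolding w_def[abs_def] by (simp add: algebra_simps inner_commute)
    have "D s \<bullet> D' s \<le> norm (D s) * norm (D' s)" by (rule norm_cauchy_schwarz)
    also have "\<dots> \<le> norm (D s) * (K * norm (D s))"
      using bound s t by (intro mult_left_mono) auto
    also have "\<dots> = K * (D s \<bullet> D s)" by (simp add: power2_norm_eq_inner[symmetric] power2_eq_square)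
    finally show "0 \<le> exp (- 2 * K * s) * (2 * (K * (D s \<bullet> D s) - D s \<bullet> D' s))" by simp
  qed
  then have "D t \<bullet> D t \<le> 0"
    using \<open>D 0 = 0\<close> by (simp add: w_def mult_le_0_iff)
  then show ?thesis by (metis inner_eq_zero_iff inner_ge_zero order_antisym)
qed

text \<open>Picard iteration, made a contraction on the whole interval at once by the weight \<open>exp (- M t)\<close>: writing
  \<open>x t = exp (M t) \<phi> t\<close>, the integral operator acting on \<open>\<phi>\<close> has Lipschitz constant at most \<open>1/2\<close> in the
  supremum norm as soon as \<open>M\<close> is at least twice the Lipschitz constant of \<open>F\<close>.\<close>

lemma Lipschitz_ode_solution_exists:
  fixes F :: "real \<Rightarrow> 'a::euclidean_space \<Rightarrow> 'a"
  assumes "0 \<le> T" and cont: "continuous_on ({0..T} \<times> UNIV) (\<lambda>(t, x). F t x)"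
    and lip: "\<And>t x y. t \<in> {0..T} \<Longrightarrow> norm (F t x - F t y) \<le> L * norm (x - y)"
  obtains x where "x 0 = x0"
    "\<And>t. t \<in> {0..T} \<Longrightarrow> (x has_vector_derivative F t (x t)) (at t within {0..T})"
proof -
  \<comment> \<open>The absolute value and the summand \<open>1\<close> make \<open>M\<close> positive for every real \<open>L\<close>.\<close>
  define M where "M = 2 * (\<bar>L\<bar> + 1)"
  have "M > 0" by (simp add: M_def)
  have lip': "norm (F t x - F t y) \<le> M / 2 * norm (x - y)" if "t \<in> {0..T}" for t x y
  proof -
    have "L * norm (x - y) \<le> M / 2 * norm (x - y)"
      by (intro mult_right_mono) (auto simp: M_def)
    with lip[OF that, of x y] show ?thesis by linarith
  qed
  define f where "f \<phi> s = F s (exp (M * s) *\<^sub>R apply_bcontfun \<phi> s)" for \<phi> :: "real \<Rightarrow>\<^sub>C 'a" and s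
  define H where "H \<phi> t = exp (- M * t) *\<^sub>R (x0 + integral {0..t} (f \<phi>))" for \<phi> t
  have f_cont: "continuous_on {0..T} (f \<phi>)" for \<phi>
    unfolding f_def
    by (rule continuous_on_compose2[OF cont, where f = "\<lambda>s. (s, exp (M * s) *\<^sub>R apply_bcontfun \<phi> s)", simplified])
      (auto intro!: continuous_intros)
  have f_int: "f \<phi> integrable_on {0..t}" if "t \<in> {0..T}" for \<phi> t
    using f_cont by (rule integrable_continuous_interval[OF continuous_on_subset]) (use that in auto)
  have "continuous_on (cbox 0 T) (H \<phi>)" for \<phi>
    unfolding H_def using f_cont
    by (auto intro!: continuous_intros indefinite_integral_continuous_1 integrable_continuous_real)
  \<comment> \<open>Functions on \<open>[0, T]\<close> are extended by constants to elements of the complete space of bounded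
    continuous functions on the line.\<close>
  then have "\<exists>g :: real \<Rightarrow>\<^sub>C 'a. \<forall>t. apply_bcontfun g t = H \<phi> (clamp 0 T t)" for \<phi>
    using continuous_on_cbox_bcontfunE by metis
  then obtain G :: "(real \<Rightarrow>\<^sub>C 'a) \<Rightarrow> real \<Rightarrow>\<^sub>C 'a"
    where G: "apply_bcontfun (G \<phi>) t = H \<phi> (clamp 0 T t)" for \<phi> t by metis
  have H_contr: "dist (H \<phi> t) (H \<psi> t) \<le> 1/2 * dist \<phi> \<psi>" if t: "t \<in> {0..T}" for \<phi> \<psi> t
  proof -
    let ?d = "dist \<phi> \<psi>"
    let ?e = "\<lambda>s. M / 2 * ?d * exp (M * s)"
    have e: "(?e has_integral (?d / 2 * exp (M * t) - ?d / 2 * exp (M * 0))) {0..t}"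
      using t \<open>M > 0\<close>
      by (intro fundamental_theorem_of_calculus)
        (auto intro!: derivative_eq_intros simp: has_real_derivative_iff_has_vector_derivative[symmetric])
    have "integral {0..t} (f \<phi>) - integral {0..t} (f \<psi>) = integral {0..t} (\<lambda>s. f \<phi> s - f \<psi> s)"
      using f_int[OF t] by (simp add: integral_diff)
    also have "norm \<dots> \<le> integral {0..t} ?e"
    proof (rule integral_norm_bound_integral)
      show "(\<lambda>s. f \<phi> s - f \<psi> s) integrable_on {0..t}" using f_int[OF t] by (intro integrable_diff)
      show "?e integrable_on {0..t}" using e by blast
      fix s assume "s \<in> {0..t}"
      then have "norm (f \<phi> s - f \<psi> s)
          \<le> M / 2 * norm (exp (M * s) *\<^sub>R apply_bcontfun \<phi> s - exp (M * s) *\<^sub>R apply_bcontfun \<psi> s)"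
        unfolding f_def using t by (intro lip') auto
      also have "\<dots> = M / 2 * (exp (M * s) * dist (apply_bcontfun \<phi> s) (apply_bcontfun \<psi> s))"
        by (simp add: scaleR_diff_right[symmetric] dist_norm)
      also have "\<dots> \<le> M / 2 * (exp (M * s) * ?d)"
        using \<open>M > 0\<close> by (intro mult_left_mono dist_bounded) auto
      finally show "norm (f \<phi> s - f \<psi> s) \<le> ?e s" by (simp add: algebra_simps)
    qed
    also have "\<dots> \<le> ?d / 2 * exp (M * t)" unfolding integral_unique[OF e] by simp
    finally have *: "norm (integral {0..t} (f \<phi>) - integral {0..t} (f \<psi>)) \<le> ?d / 2 * exp (M * t)" .
    have "dist (H \<phi> t) (H \<psi> t) = exp (- M * t) * norm (integral {0..t} (f \<phi>) - integral {0..t} (f \<psi>))"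
      by (simp add: H_def dist_norm scaleR_diff_right[symmetric])
    also have "\<dots> \<le> exp (- M * t) * (?d / 2 * exp (M * t))"
      using * by (intro mult_left_mono) auto
    finally show ?thesis by (simp add: exp_minus field_simps)
  qed
  have "dist (G \<phi>) (G \<psi>) \<le> 1/2 * dist \<phi> \<psi>" for \<phi> \<psi>
  proof (rule dist_bound)
    fix t
    have "clamp 0 T t \<in> cbox 0 T" using \<open>0 \<le> T\<close> by (intro clamp_in_interval) auto
    then show "dist (apply_bcontfun (G \<phi>) t) (apply_bcontfun (G \<psi>) t) \<le> 1/2 * dist \<phi> \<psi>"
      unfolding G by (intro H_contr) simp
  qed
  then obtain \<phi> where "G \<phi> = \<phi>"
    using banach_fix_type[of "1/2" G] by auto
  then have fixpoint: "apply_bcontfun \<phi> t = H \<phi> t" if "t \<in> {0..T}" for t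
    using G[of \<phi> t] that by (simp add: clamp_cancel_cbox)
  define x where "x t = x0 + integral {0..t} (f \<phi>)" for t
  have x_eq: "exp (M * t) *\<^sub>R apply_bcontfun \<phi> t = x t" if "t \<in> {0..T}" for t
    unfolding fixpoint[OF that] H_def x_def by (simp add: exp_minus)
  show thesis
  proof
    show "x 0 = x0" by (simp add: x_def)
    fix t assume t: "t \<in> {0..T}"
    have "(x has_vector_derivative f \<phi> t) (at t within {0..T})"
      unfolding x_def using integral_has_vector_derivative[OF f_cont t]
      by (auto intro!: derivative_eq_intros)
    then show "(x has_vector_derivative F t (x t)) (at t within {0..T})"
      by (simp add: f_def x_eq[OF t])
  qed
qed

lemma affine_field_Lipschitz:
  fixes A :: "real \<Rightarrow> real^'n^'n"
  assumes "continuous_on {0..T} A"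
  obtains K where "\<And>t v w. t \<in> {0..T} \<Longrightarrow> norm ((A t *v v + b t) - (A t *v w + b t)) \<le> K * norm (v - w)"
proof -
  obtain c where c: "c > 0" "\<And>A v. norm ((A :: real^'n^'n) *v (v :: real^'n)) \<le> norm A * norm v * c"
    using mv.pos_bounded by blast
  obtain B where B: "\<And>t. t \<in> {0..T} \<Longrightarrow> norm (A t) \<le> B"
    using continuous_function_bounded[OF assms] by blast
  show thesis
  proof (rule that)
    fix t v w assume t: "t \<in> {0..T}"
    have "norm ((A t *v v + b t) - (A t *v w + b t)) = norm (A t *v (v - w))" by (simp add: mv.diff_right)
    also have "\<dots> \<le> norm (A t) * norm (v - w) * c" by (rule c)
    also have "\<dots> \<le> B * norm (v - w) * c"
      using B[OF t] c(1) by (intro mult_right_mono) auto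
    finally show "norm ((A t *v v + b t) - (A t *v w + b t)) \<le> B * c * norm (v - w)" by (simp add: algebra_simps)
  qed
qed

lemma linear_ode_solution_exists:
  fixes A :: "real \<Rightarrow> real^'n^'n" and b :: "real \<Rightarrow> real^'n"
  assumes "0 \<le> T" and A: "continuous_on {0..T} A" and b: "continuous_on {0..T} b"
  obtains x where "x 0 = x0"
    "\<And>t. t \<in> {0..T} \<Longrightarrow> (x has_vector_derivative A t *v x t + b t) (at t within {0..T})"
proof -
  obtain K where K: "\<And>t v w. t \<in> {0..T} \<Longrightarrow> norm ((A t *v v + b t) - (A t *v w + b t)) \<le> K * norm (v - w)"
    using affine_field_Lipschitz[OF A] by blast
  have "continuous_on ({0..T} \<times> UNIV) (\<lambda>(t, x). A t *v x + b t)"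
    unfolding split_beta
    by (intro continuous_on_add mv.continuous_on continuous_on_compose2[OF A] continuous_on_compose2[OF b] continuous_intros) auto
  from Lipschitz_ode_solution_exists[OF \<open>0 \<le> T\<close> this K, of x0] that show thesis by blast
qed

text \<open>Time reversal \<open>t \<mapsto> T - t\<close> turns a terminal value into an initial value.\<close>

lemma linear_ode_terminal_value_solution_exists:
  fixes A :: "real \<Rightarrow> real^'n^'n" and b :: "real \<Rightarrow> real^'n"
  assumes "0 \<le> T" and A: "continuous_on {0..T} A" and b: "continuous_on {0..T} b"
  obtains x where "x T = x1"
    "\<And>t. t \<in> {0..T} \<Longrightarrow> (x has_vector_derivative A t *v x t + b t) (at t within {0..T})"
proof -
  have rev: "continuous_on {0..T} (\<lambda>t. g (T - t))" if "continuous_on {0..T} g" for g :: "real \<Rightarrow> 'b::real_normed_vector"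
    by (rule continuous_on_compose2[OF that]) (auto intro!: continuous_intros)
  obtain w where w0: "w 0 = x1"
    and w: "\<And>t. t \<in> {0..T} \<Longrightarrow> (w has_vector_derivative - A (T - t) *v w t + - b (T - t)) (at t within {0..T})"
    by (rule linear_ode_solution_exists[OF \<open>0 \<le> T\<close>, of "\<lambda>t. - A (T - t)" "\<lambda>t. - b (T - t)" x1])
      (intro continuous_on_minus rev A b | rule that)+
  show thesis
  proof (rule that[of "\<lambda>t. w (T - t)"])
    show "w (T - T) = x1" using w0 by simp
    fix t assume t: "t \<in> {0..T}"
    have img: "(\<lambda>t. T - t) ` {0..T} = {0..T}" by (auto simp: image_iff intro!: bexI[of _ "T - _"])
    have "((\<lambda>t. T - t) has_vector_derivative -1) (at t within {0..T})"
      by (auto intro!: derivative_eq_intros)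
    moreover have "(w has_vector_derivative - A t *v w (T - t) + - b t) (at (T - t) within (\<lambda>t. T - t) ` {0..T})"
      using w[of "T - t"] t unfolding img by simp
    ultimately have "((w \<circ> (\<lambda>t. T - t)) has_vector_derivative -1 *\<^sub>R (- A t *v w (T - t) + - b t)) (at t within {0..T})"
      by (rule vector_diff_chain_within)
    then show "((\<lambda>t. w (T - t)) has_vector_derivative A t *v w (T - t) + b t) (at t within {0..T})"
      by (simp add: o_def mv.minus_left add.commute)
  qed
qed

section \<open>The matrix Riccati equation\<close>

definition riccati_solution ::
    "real^'n^'n \<Rightarrow> real^'n^'n \<Rightarrow> real^'n^'n \<Rightarrow> real \<Rightarrow> (real \<Rightarrow> real^'n^'n) \<Rightarrow> bool" where
  "riccati_solution L W R T P \<longleftrightarrow> (\<forall>t\<in>{0..T}. (P has_vector_derivative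
     W - transpose L ** P t - P t ** L - P t ** R ** P t) (at t within {0..T}))"

lemma riccati_solution_continuous:
  "riccati_solution L W R T P \<Longrightarrow> continuous_on {0..T} P"
  by (auto simp: riccati_solution_def intro: continuous_on_if_has_vector_derivative)

text \<open>The difference \<open>D\<close> of two solutions solves a homogeneous linear equation, since
  \<open>P1 R P1 - P2 R P2 = D R P1 + P2 R D\<close>.\<close>

lemma riccati_solution_unique:
  fixes L W R :: "real^'n^'n"
  assumes P1: "riccati_solution L W R T P1" and P2: "riccati_solution L W R T P2"
    and "P1 0 = P2 0" and t: "t \<in> {0..T}"
  shows "P1 t = P2 t"
proof -
  define D where "D s = P1 s - P2 s" for s
  define D' where "D' s = - (transpose L ** D s) - D s ** L - D s ** R ** P1 s - P2 s ** R ** D s" for s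
  obtain c where c: "c > 0" "\<And>A B. norm ((A :: real^'n^'n) ** (B :: real^'n^'n)) \<le> norm A * norm B * c"
    using mm.pos_bounded by blast
  obtain B1 B2 where B: "\<And>s. s \<in> {0..T} \<Longrightarrow> norm (P1 s) \<le> B1" "\<And>s. s \<in> {0..T} \<Longrightarrow> norm (P2 s) \<le> B2"
    using continuous_function_bounded riccati_solution_continuous P1 P2 by metis
  define K where "K = (norm (transpose L) + norm L + norm R * c * B1 + norm R * c * B2) * c"
  have "D t = 0"
  proof (rule zero_if_derivative_bounded_by_norm[OF _ _ _ t])
    show "D 0 = 0" by (simp add: D_def assms(3))
    fix s assume s: "s \<in> {0..T}"
    have "(D has_vector_derivative (W - transpose L ** P1 s - P1 s ** L - P1 s ** R ** P1 s)
       - (W - transpose L ** P2 s - P2 s ** L - P2 s ** R ** P2 s)) (at s within {0..T})"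
      unfolding D_def using P1 P2 s
      by (intro has_vector_derivative_diff) (auto simp: riccati_solution_def)
    also have "(W - transpose L ** P1 s - P1 s ** L - P1 s ** R ** P1 s)
       - (W - transpose L ** P2 s - P2 s ** L - P2 s ** R ** P2 s) = D' s"
      by (simp add: D_def D'_def mm.diff_left mm.diff_right)
    finally show "(D has_vector_derivative D' s) (at s within {0..T})" .
    have "norm (D s ** R ** P1 s) \<le> norm (D s) * norm R * c * norm (P1 s) * c"
      using c(2)[of "D s ** R" "P1 s"] mult_right_mono[OF c(2)[of "D s" R], of "norm (P1 s) * c"] c(1)
      by (simp add: mult.assoc)
    also have "\<dots> \<le> norm (D s) * norm R * c * B1 * c"
      using B(1)[OF s] c(1) by (intro mult_right_mono mult_left_mono) auto
    finally have 1: "norm (D s ** R ** P1 s) \<le> norm (D s) * norm R * c * B1 * c" .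
    have "norm (P2 s ** R ** D s) \<le> norm (P2 s) * norm R * c * norm (D s) * c"
      using c(2)[of "P2 s ** R" "D s"] mult_right_mono[OF c(2)[of "P2 s" R], of "norm (D s) * c"] c(1)
      by (simp add: mult.assoc)
    also have "\<dots> \<le> B2 * norm R * c * norm (D s) * c"
      using B(2)[OF s] c(1) by (intro mult_right_mono) auto
    finally have 2: "norm (P2 s ** R ** D s) \<le> B2 * norm R * c * norm (D s) * c" .
    have "norm (D' s) \<le> norm (transpose L ** D s) + norm (D s ** L) + norm (D s ** R ** P1 s) + norm (P2 s ** R ** D s)"
      unfolding D'_def
      using norm_triangle_ineq4[of "- (transpose L ** D s) - D s ** L - D s ** R ** P1 s" "P2 s ** R ** D s"]
        norm_triangle_ineq4[of "- (transpose L ** D s) - D s ** L" "D s ** R ** P1 s"]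
        norm_triangle_ineq4[of "- (transpose L ** D s)" "D s ** L"]
      unfolding norm_minus_cancel by linarith
    also have "\<dots> \<le> K * norm (D s)"
      using 1 2 c(2)[of "transpose L" "D s"] c(2)[of "D s" L] by (simp add: K_def algebra_simps)
    finally show "norm (D' s) \<le> K * norm (D s)" .
  qed
  then show ?thesis by (simp add: D_def)
qed

text \<open>Transposition maps solutions to solutions when the weights are symmetric.\<close>

lemma riccati_solution_symmetric:
  assumes P: "riccati_solution L W R T P" and "transpose W = W" "transpose R = R"
    and "transpose (P 0) = P 0" and t: "t \<in> {0..T}"
  shows "transpose (P t) = P t"
proof (rule riccati_solution_unique[OF _ P _ t])
  show "riccati_solution L W R T (\<lambda>t. transpose (P t))"
    unfolding riccati_solution_def
  proof
    fix s assume "s \<in> {0..T}"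
    then have "(P has_vector_derivative W - transpose L ** P s - P s ** L - P s ** R ** P s)
        (at s within {0..T})"
      using P by (auto simp: riccati_solution_def)
    from bounded_linear.has_vector_derivative[OF bounded_linear_transpose this]
    show "((\<lambda>t. transpose (P t)) has_vector_derivative W - transpose L ** transpose (P s)
        - transpose (P s) ** L - transpose (P s) ** R ** transpose (P s)) (at s within {0..T})"
      by (simp add: transpose_simps matrix_transpose_mul assms(2,3) matrix_mul_assoc algebra_simps)
  qed
qed fact

text \<open>The Riccati equation is the flow of the linear Hamiltonian system \<open>X' = L X + R Y\<close>, \<open>Y' = W X - L\<^sup>T Y\<close> read in
  the chart \<open>P = Y X\<^sup>-\<^sup>1\<close>. Finite-time blow-up would be a singularity of \<open>X\<close>. It is excluded, with
  positivity as a by-product, by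
  \<open>((X v) \<bullet> (Y v))' = (X v) \<bullet> W (X v) + (Y v) \<bullet> R (Y v) \<ge> 0\<close>.\<close>

lemma riccati_solution_exists:
  fixes L W R S :: "real^'n^'n"
  assumes "0 \<le> T" and "pos_def R" and W: "\<And>v. 0 \<le> quad_form W v" "transpose W = W" and S: "pos_def S"
  obtains P where "riccati_solution L W R T P" "P 0 = S" "\<And>t. t \<in> {0..T} \<Longrightarrow> pos_def (P t)"
proof -
  define G where "G p = (L ** fst p + R ** snd p, W ** fst p - transpose L ** snd p)"
    for p :: "(real^'n^'n) \<times> (real^'n^'n)"
  have G: "bounded_linear G"
    unfolding linear_conv_bounded_linear[symmetric]
    by (rule linearI) (auto simp: G_def mm.add_right mm.scaleR_right algebra_simps)
  obtain K where K: "norm (G p) \<le> norm p * K" for p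
    using bounded_linear.bounded[OF G] by blast
  obtain Z where Z0: "Z 0 = (mat 1, S)"
    and Z: "\<And>t. t \<in> {0..T} \<Longrightarrow> (Z has_vector_derivative G (Z t)) (at t within {0..T})"
  proof (rule Lipschitz_ode_solution_exists[where F = "\<lambda>t. G" and L = K])
    show "continuous_on ({0..T} \<times> UNIV) (\<lambda>(t, x). G x)"
      unfolding split_beta by (intro bounded_linear.continuous_on[OF G] continuous_intros)
    show "norm (G p - G q) \<le> K * norm (p - q)" for p q
      using K[of "p - q"] by (simp add: linear_simps[OF G] mult.commute)
  qed (use assms in auto)
  define X where "X t = fst (Z t)" for t
  define Y where "Y t = snd (Z t)" for t
  have X: "(X has_vector_derivative L ** X t + R ** Y t) (at t within {0..T})"
    and Y: "(Y has_vector_derivative W ** X t - transpose L ** Y t) (at t within {0..T})" if "t \<in> {0..T}" for t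
    using bounded_linear.has_vector_derivative[OF bounded_linear_fst Z[OF that]]
      bounded_linear.has_vector_derivative[OF bounded_linear_snd Z[OF that]]
    unfolding X_def[abs_def] Y_def[abs_def] by (simp_all add: G_def)
  have pos: "0 < (X t *v v) \<bullet> (Y t *v v)" if t: "t \<in> {0..T}" and "v \<noteq> 0" for t v
  proof -
    have "0 < quad_form S v" using S \<open>v \<noteq> 0\<close> by (auto simp: pos_def_def)
    also have "quad_form S v = (X 0 *v v) \<bullet> (Y 0 *v v)" by (simp add: X_def Y_def Z0 quad_form_def)
    also have "\<dots> \<le> (X t *v v) \<bullet> (Y t *v v)"
    proof (rule nondecreasing_if_derivative_nonneg[where f = "\<lambda>t. (X t *v v) \<bullet> (Y t *v v)"])
      show "0 \<le> t" using t by simp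
      fix s assume s: "s \<in> {0..t}"
      have XY: "(X has_vector_derivative L ** X s + R ** Y s) (at s within {0..t})"
        "(Y has_vector_derivative W ** X s - transpose L ** Y s) (at s within {0..t})"
        using X[of s] Y[of s] s t by (auto intro: has_vector_derivative_subinterval)
      from bounded_bilinear.has_vector_derivative[OF bounded_bilinear_inner
          bounded_linear.has_vector_derivative[OF mv.bounded_linear_left XY(1)]
          bounded_linear.has_vector_derivative[OF mv.bounded_linear_left XY(2)], of v v]
      show "((\<lambda>t. (X t *v v) \<bullet> (Y t *v v)) has_vector_derivative
          quad_form W (X s *v v) + quad_form R (Y s *v v)) (at s within {0..t})"
        using inner_matrix_vector_transpose[of "X s *v v" "transpose L" "Y s *v v"]
        by (simp add: quad_form_def mv.add_left mv.diff_left inner_diff_right inner_add_left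
            matrix_vector_mul_assoc[symmetric] inner_commute[of "Y s *v v"] del: transpose_matrix_vector)
      show "0 \<le> quad_form W (X s *v v) + quad_form R (Y s *v v)"
        using W quad_form_nonneg[OF \<open>pos_def R\<close>] by (intro add_nonneg_nonneg) auto
    qed
    finally show ?thesis .
  qed
  have inv: "invertible (X t)" if "t \<in> {0..T}" for t
    using pos[OF that] by (intro invertible_if_kernel_trivial) force
  have X_cont: "continuous_on {0..T} X" using X by (rule continuous_on_if_has_vector_derivative)
  define P where "P t = Y t ** matrix_inv (X t)" for t
  have P: "riccati_solution L W R T P"
    unfolding riccati_solution_def
  proof
    fix t assume t: "t \<in> {0..T}"
    from mm.has_vector_derivative[OF Y[OF t] has_vector_derivative_matrix_inv[OF X[OF t] inv t X_cont]]
    show "(P has_vector_derivative W - transpose L ** P t - P t ** L - P t ** R ** P t) (at t within {0..T})"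
      unfolding P_def
      by (simp add: mm.add_left mm.add_right mm.diff_left mm.diff_right mm.minus_right
          matrix_mul_assoc[symmetric] matrix_inv_inverse[OF inv[OF t]] algebra_simps)
  qed
  moreover have P0: "P 0 = S"
    by (simp add: P_def X_def Y_def Z0 matrix_inv_unique)
  moreover have "pos_def (P t)" if t: "t \<in> {0..T}" for t
    unfolding pos_def_def
  proof (intro conjI allI impI)
    show "transpose (P t) = P t"
      using riccati_solution_symmetric[OF P] W \<open>pos_def R\<close> S t P0 by (simp add: pos_def_def)
    fix w :: "real^'n" assume "w \<noteq> 0"
    define v where "v = matrix_inv (X t) *v w"
    have w: "w = X t *v v" by (simp add: v_def matrix_inv_inverse_vector[OF inv[OF t]])
    with \<open>w \<noteq> 0\<close> have "v \<noteq> 0" by auto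
    from pos[OF t this] show "0 < quad_form (P t) w"
      by (simp add: w quad_form_def P_def matrix_vector_mul_assoc[symmetric] matrix_inv_inverse_vector[OF inv[OF t]])
  qed
  ultimately show thesis by (rule that)
qed

section \<open>Chain rule along integral curves\<close>

text \<open>A substitute for differentiating: if the increments of \<open>F\<close> are dominated, at every sufficiently fine
  scale, by an arbitrarily small multiple of those of one fixed function, then summation over a uniform
  partition shows that \<open>F\<close> has no total increment.\<close>

lemma eq_if_increments_small:
  fixes F m :: "real \<Rightarrow> real"
  assumes "0 \<le> t"
    and local_bound: "\<And>\<epsilon>. 0 < \<epsilon> \<Longrightarrow> \<exists>\<eta>>0. \<forall>a b. 0 \<le> a \<longrightarrow> a \<le> b \<longrightarrow> b \<le> t \<longrightarrow> b - a < \<eta> \<longrightarrow>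
        \<bar>F b - F a\<bar> \<le> \<epsilon> * (m b - m a)"
  shows "F t = F 0"
proof -
  have *: "\<bar>F t - F 0\<bar> \<le> \<epsilon> * (m t - m 0)" if pos: "0 < \<epsilon>" for \<epsilon>
  proof -
    obtain \<eta> where "\<eta> > 0" and \<eta>: "\<And>a b. 0 \<le> a \<Longrightarrow> a \<le> b \<Longrightarrow> b \<le> t \<Longrightarrow> b - a < \<eta> \<Longrightarrow>
        \<bar>F b - F a\<bar> \<le> \<epsilon> * (m b - m a)"
      using local_bound[OF pos] by blast
    obtain N :: nat where N: "t / \<eta> < real N" using reals_Archimedean2 by blast
    with \<open>0 \<le> t\<close> \<open>\<eta> > 0\<close> have "N > 0" by (metis divide_nonneg_pos gr0I not_le of_nat_0)
    with N \<open>\<eta> > 0\<close> have small: "t / N < \<eta>" by (simp add: field_simps)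
    have "\<bar>F (k * (t / N)) - F 0\<bar> \<le> \<epsilon> * (m (k * (t / N)) - m 0)" if "k \<le> N" for k :: nat
      using that
    proof (induction k)
      case (Suc k)
      have "\<bar>F (Suc k * (t / N)) - F (k * (t / N))\<bar> \<le> \<epsilon> * (m (Suc k * (t / N)) - m (k * (t / N)))"
      proof (rule \<eta>)
        have "real (Suc k) * (t / N) \<le> real N * (t / N)"
          using Suc.prems \<open>0 \<le> t\<close> by (intro mult_right_mono) auto
        then show "real (Suc k) * (t / N) \<le> t" using \<open>N > 0\<close> by simp
        show "real (Suc k) * (t / N) - real k * (t / N) < \<eta>"
          using small by (simp add: add_divide_distrib distrib_right)
      qed (use \<open>0 \<le> t\<close> in \<open>auto intro!: divide_right_mono mult_right_mono\<close>)
      with Suc show ?case by (simp add: right_diff_distrib)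
    qed simp
    from this[of N] \<open>N > 0\<close> show ?thesis by simp
  qed
  have "\<bar>F t - F 0\<bar> \<le> 0"
  proof (rule field_le_epsilon)
    fix e :: real assume "0 < e"
    \<comment> \<open>The summand \<open>1\<close> guards against \<open>m t = m 0\<close>.\<close>
    let ?\<epsilon> = "e / (\<bar>m t - m 0\<bar> + 1)"
    have "\<bar>F t - F 0\<bar> \<le> ?\<epsilon> * (m t - m 0)" using \<open>0 < e\<close> by (intro *) simp
    also have "\<dots> \<le> ?\<epsilon> * (\<bar>m t - m 0\<bar> + 1)" using \<open>0 < e\<close> by (intro mult_left_mono) auto
    also have "\<dots> = e" by simp
    finally show "\<bar>F t - F 0\<bar> \<le> 0 + e" by simp
  qed
  then show ?thesis by simp
qed

lemma continuous_on_indefinite_integral: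
  fixes \<gamma> :: "real \<Rightarrow> 'a::banach"
  assumes "\<And>\<tau>. \<tau> \<in> {0..t} \<Longrightarrow> (w has_integral \<gamma> \<tau> - \<gamma> 0) {0..\<tau>}" "0 \<le> t"
  shows "continuous_on {0..t} \<gamma>"
proof -
  have "w integrable_on {0..t}" using assms by fastforce
  then have "continuous_on {0..t} (\<lambda>\<tau>. \<gamma> 0 + integral {0..\<tau>} w)"
    by (intro continuous_intros indefinite_integral_continuous_1)
  moreover have "\<gamma> 0 + integral {0..\<tau>} w = \<gamma> \<tau>" if "\<tau> \<in> {0..t}" for \<tau>
    using integral_unique[OF assms(1)[OF that]] by simp
  ultimately show ?thesis by (rule continuous_on_eq)
qed

lemma absolutely_integrable_inner_continuous:
  fixes w p :: "real \<Rightarrow> 'a::euclidean_space"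
  assumes "w absolutely_integrable_on {0..t}" "continuous_on {0..t} p"
  shows "(\<lambda>\<tau>. p \<tau> \<bullet> w \<tau>) absolutely_integrable_on {0..t}"
proof (rule absolutely_integrable_bounded_measurable_product[OF
      bilinear_conv_bounded_bilinear[THEN iffD2, OF bounded_bilinear_inner]])
  show "p \<in> borel_measurable (lebesgue_on {0..t})"
    using assms(2) by (intro continuous_imp_measurable_on_sets_lebesgue) auto
  show "bounded (p ` {0..t})"
    using assms(2) by (intro compact_imp_bounded compact_continuous_image compact_Icc)
qed (use assms in auto)

text \<open>The curve \<open>\<gamma>\<close> is only an indefinite integral of \<open>w\<close>. On a short interval \<open>[a, b]\<close> both
  \<open>g (\<gamma> b) - g (\<gamma> a)\<close> and the integral of \<open>D (\<gamma> \<tau>) \<bullet> w \<tau>\<close> differ from \<open>D (\<gamma> a) \<bullet> (\<gamma> b - \<gamma> a)\<close> by at most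
  \<open>\<epsilon>/2\<close> times the integral of \<open>|w|\<close>, because \<open>D\<close> is uniformly continuous on the compact convex hull of the
  curve. Convexity of \<open>S\<close> keeps the chords of the curve inside the domain of \<open>g\<close>.\<close>

lemma caratheodory_chain_rule:
  fixes g :: "'a::euclidean_space \<Rightarrow> real" and \<gamma> w :: "real \<Rightarrow> 'a"
  assumes "convex S"
    and g: "\<And>x. x \<in> S \<Longrightarrow> (g has_derivative (\<lambda>v. D x \<bullet> v)) (at x within S)"
    and D: "continuous_on S D"
    and "0 \<le> t" and w: "w absolutely_integrable_on {0..t}"
    and \<gamma>: "\<And>\<tau>. \<tau> \<in> {0..t} \<Longrightarrow> (w has_integral \<gamma> \<tau> - \<gamma> 0) {0..\<tau>}"
    and \<gamma>_S: "\<And>\<tau>. \<tau> \<in> {0..t} \<Longrightarrow> \<gamma> \<tau> \<in> S"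
  shows "((\<lambda>\<tau>. D (\<gamma> \<tau>) \<bullet> w \<tau>) has_integral g (\<gamma> t) - g (\<gamma> 0)) {0..t}"
proof -
  have \<gamma>_cont: "continuous_on {0..t} \<gamma>"
    using \<gamma> \<open>0 \<le> t\<close> by (rule continuous_on_indefinite_integral)
  define K where "K = convex hull (\<gamma> ` {0..t})"
  have "compact K"
    unfolding K_def by (intro compact_convex_hull compact_continuous_image \<gamma>_cont compact_Icc)
  have "K \<subseteq> S"
    unfolding K_def using \<gamma>_S \<open>convex S\<close> by (intro hull_minimal) auto
  have \<gamma>_K: "\<gamma> \<tau> \<in> K" if "\<tau> \<in> {0..t}" for \<tau>
    unfolding K_def using that by (intro hull_inc) auto
  have D\<gamma>: "continuous_on {0..t} (\<lambda>\<tau>. D (\<gamma> \<tau>))"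
    by (rule continuous_on_compose2[OF D \<gamma>_cont]) (use \<gamma>_S in auto)
  define v where "v \<tau> = D (\<gamma> \<tau>) \<bullet> w \<tau>" for \<tau>
  have v: "v integrable_on {0..t}"
    unfolding v_def[abs_def] using absolutely_integrable_inner_continuous[OF w D\<gamma>]
    by (simp add: absolutely_integrable_on_def)
  have nw: "(\<lambda>\<tau>. norm (w \<tau>)) integrable_on {0..t}"
    using w by (simp add: absolutely_integrable_on_def)
  have w': "w integrable_on {0..t}"
    using w by (simp add: absolutely_integrable_on_def)
  define F where "F \<tau> = g (\<gamma> \<tau>) - integral {0..\<tau>} v" for \<tau>
  define m where "m \<tau> = integral {0..\<tau>} (\<lambda>\<tau>. norm (w \<tau>))" for \<tau>
  have "F t = F 0"
  proof (rule eq_if_increments_small[OF \<open>0 \<le> t\<close>])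
    fix \<epsilon> :: real assume "0 < \<epsilon>"
    then have e: "0 < \<epsilon> / 2" by simp
    obtain \<delta> where "\<delta> > 0" and \<delta>: "\<And>x y. x \<in> K \<Longrightarrow> y \<in> K \<Longrightarrow> dist y x < \<delta> \<Longrightarrow> dist (D y) (D x) < \<epsilon> / 2"
      by (rule uniformly_continuous_onE[OF compact_uniformly_continuous[OF
            continuous_on_subset[OF D \<open>K \<subseteq> S\<close>] \<open>compact K\<close>] e]) (rule that)
    obtain \<eta> where "\<eta> > 0" and \<eta>: "\<And>a b. a \<in> {0..t} \<Longrightarrow> b \<in> {0..t} \<Longrightarrow> dist b a < \<eta> \<Longrightarrow> dist (\<gamma> b) (\<gamma> a) < \<delta>"
      by (rule uniformly_continuous_onE[OF compact_uniformly_continuous[OF \<gamma>_cont compact_Icc] \<open>\<delta> > 0\<close>]) (rule that)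
    have "\<bar>F b - F a\<bar> \<le> \<epsilon> * (m b - m a)" if ab: "0 \<le> a" "a \<le> b" "b \<le> t" "b - a < \<eta>" for a b
    proof -
      have sub: "{a..b} \<subseteq> {0..t}" and a: "a \<in> {0..t}" and b: "b \<in> {0..t}" using ab by auto
      have increment: "integral {0..b} f - integral {0..a} f = integral {a..b} f"
        if "f integrable_on {0..t}" for f :: "real \<Rightarrow> 'b::banach"
      proof -
        have "f integrable_on {0..b}" using that by (rule integrable_on_subinterval) (use ab in auto)
        from Henstock_Kurzweil_Integration.integral_combine[OF ab(1,2) this] show ?thesis by (simp add: algebra_simps)
      qed
      have int: "f integrable_on {a..b}" if "f integrable_on {0..t}" for f :: "real \<Rightarrow> 'b::banach"
        using that sub by (rule integrable_on_subinterval)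
      have w_ab: "integral {a..b} w = \<gamma> b - \<gamma> a"
        using increment[OF w'] integral_unique[OF \<gamma>[OF a]] integral_unique[OF \<gamma>[OF b]] by simp
      have m_ab: "integral {a..b} (\<lambda>\<tau>. norm (w \<tau>)) = m b - m a"
        using increment[OF nw] by (simp add: m_def)
      have "norm (\<gamma> b - \<gamma> a) \<le> m b - m a"
        unfolding w_ab[symmetric] m_ab[symmetric]
        by (rule integral_norm_bound_integral[OF int[OF w'] int[OF nw]]) simp
      let ?seg = "closed_segment (\<gamma> a) (\<gamma> b)"
      have seg: "?seg \<subseteq> K"
        using \<gamma>_K[OF a] \<gamma>_K[OF b] convex_convex_hull unfolding K_def by (intro closed_segment_subset)
      have "norm (g (\<gamma> b) - g (\<gamma> a) - D (\<gamma> a) \<bullet> (\<gamma> b - \<gamma> a)) \<le> norm (\<gamma> b - \<gamma> a) * (\<epsilon> / 2)"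
      proof (rule differentiable_bound_linearization[where S = ?seg and f' = "\<lambda>x v. D x \<bullet> v"])
        show "\<gamma> a + \<tau> *\<^sub>R (\<gamma> b - \<gamma> a) \<in> ?seg" if "\<tau> \<in> {0..1}" for \<tau>
          unfolding in_segment using that by (intro exI[of _ \<tau>]) (auto simp: algebra_simps)
        show "(g has_derivative (\<lambda>v. D x \<bullet> v)) (at x within ?seg)" if "x \<in> ?seg" for x
          using g[of x] that seg \<open>K \<subseteq> S\<close> by (meson has_derivative_subset subset_iff subset_trans)
        show "onorm ((\<lambda>v. D x \<bullet> v) - (\<lambda>v. D (\<gamma> a) \<bullet> v)) \<le> \<epsilon> / 2" if "x \<in> ?seg" for x
        proof (rule onorm_le)
          fix v :: "'a"
          have "dist x (\<gamma> a) \<le> dist (\<gamma> a) (\<gamma> b)"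
            using that segment_bound1[of x "\<gamma> a" "\<gamma> b"] by (simp add: dist_norm norm_minus_commute)
          also have "\<dots> < \<delta>" using \<eta>[OF a b] ab by (simp add: dist_real_def dist_commute)
          finally have "dist (D x) (D (\<gamma> a)) < \<epsilon> / 2"
            using that seg \<gamma>_K[OF a] by (intro \<delta>) auto
          then have "norm (D x - D (\<gamma> a)) * norm v \<le> \<epsilon> / 2 * norm v"
            by (intro mult_right_mono) (auto simp: dist_norm)
          then show "norm (((\<lambda>v. D x \<bullet> v) - (\<lambda>v. D (\<gamma> a) \<bullet> v)) v) \<le> \<epsilon> / 2 * norm v"
            using Cauchy_Schwarz_ineq2[of "D x - D (\<gamma> a)" v] by (simp add: inner_diff_left)
        qed
      qed auto
      also have "\<dots> \<le> (m b - m a) * (\<epsilon> / 2)"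
        using \<open>norm (\<gamma> b - \<gamma> a) \<le> m b - m a\<close> \<open>0 < \<epsilon>\<close> by (intro mult_right_mono) auto
      finally have 1: "norm (g (\<gamma> b) - g (\<gamma> a) - D (\<gamma> a) \<bullet> (\<gamma> b - \<gamma> a)) \<le> (m b - m a) * (\<epsilon> / 2)" .
      have Dw: "(\<lambda>\<tau>. D (\<gamma> a) \<bullet> w \<tau>) integrable_on {a..b}"
        using integrable_linear[OF int[OF w'] bounded_linear_inner_right, of "D (\<gamma> a)"] by (simp add: o_def)
      have "integral {a..b} v - D (\<gamma> a) \<bullet> (\<gamma> b - \<gamma> a) = integral {a..b} v - integral {a..b} (\<lambda>\<tau>. D (\<gamma> a) \<bullet> w \<tau>)"
        using integral_linear[OF int[OF w'] bounded_linear_inner_right, of "D (\<gamma> a)"] w_ab by (simp add: o_def)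
      also have "\<dots> = integral {a..b} (\<lambda>\<tau>. v \<tau> - D (\<gamma> a) \<bullet> w \<tau>)"
        using int[OF v] Dw by (simp add: integral_diff)
      also have "norm \<dots> \<le> integral {a..b} (\<lambda>\<tau>. \<epsilon> / 2 * norm (w \<tau>))"
      proof (rule integral_norm_bound_integral)
        fix \<tau> assume "\<tau> \<in> {a..b}"
        then have \<tau>: "\<tau> \<in> {0..t}" "dist \<tau> a < \<eta>" using sub ab by (auto simp: dist_real_def)
        have "dist (D (\<gamma> \<tau>)) (D (\<gamma> a)) < \<epsilon> / 2"
          using \<eta>[OF a \<tau>(1) \<tau>(2)] \<gamma>_K[OF \<tau>(1)] \<gamma>_K[OF a] by (intro \<delta>)
        then have "norm (D (\<gamma> \<tau>) - D (\<gamma> a)) * norm (w \<tau>) \<le> \<epsilon> / 2 * norm (w \<tau>)"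
          by (intro mult_right_mono) (auto simp: dist_norm)
        then show "norm (v \<tau> - D (\<gamma> a) \<bullet> w \<tau>) \<le> \<epsilon> / 2 * norm (w \<tau>)"
          using Cauchy_Schwarz_ineq2[of "D (\<gamma> \<tau>) - D (\<gamma> a)" "w \<tau>"] by (simp add: v_def inner_diff_left)
      qed (use int[OF v] Dw int[OF nw] in \<open>auto intro!: integrable_diff integrable_on_mult_right\<close>)
      also have "\<dots> = \<epsilon> / 2 * (m b - m a)" by (simp add: m_ab)
      finally have 2: "norm (integral {a..b} v - D (\<gamma> a) \<bullet> (\<gamma> b - \<gamma> a)) \<le> \<epsilon> / 2 * (m b - m a)" .
      have "F b - F a = g (\<gamma> b) - g (\<gamma> a) - integral {a..b} v"
        using increment[OF v] by (simp add: F_def)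
      then have "\<bar>F b - F a\<bar> \<le> (m b - m a) * (\<epsilon> / 2) + \<epsilon> / 2 * (m b - m a)"
        using 1 2 unfolding real_norm_def by linarith
      then show ?thesis by (simp add: field_simps)
    qed
    with \<open>\<eta> > 0\<close> show "\<exists>\<eta>>0. \<forall>a b. 0 \<le> a \<longrightarrow> a \<le> b \<longrightarrow> b \<le> t \<longrightarrow> b - a < \<eta> \<longrightarrow>
        \<bar>F b - F a\<bar> \<le> \<epsilon> * (m b - m a)" by blast
  qed
  then have "integral {0..t} v = g (\<gamma> t) - g (\<gamma> 0)" by (simp add: F_def)
  with integrable_integral[OF v] show ?thesis by (simp add: v_def[abs_def])
qed

lemma absolutely_integrable_on_Pair_const:
  fixes w :: "real \<Rightarrow> 'a::euclidean_space"
  assumes "w absolutely_integrable_on {0..t}"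
  shows "(\<lambda>\<tau>. (w \<tau>, c :: real)) absolutely_integrable_on {0..t}"
proof -
  have "bounded_linear (\<lambda>v::'a. (v, 0 :: real))"
    by (intro bounded_linear_Pair bounded_linear_ident bounded_linear_zero)
  from absolutely_integrable_linear[OF assms this]
  have "(\<lambda>\<tau>. (w \<tau>, 0 :: real) + (0, c)) absolutely_integrable_on {0..t}"
    by (intro set_integral_add(1)) (auto simp: o_def intro!: absolutely_integrable_continuous_real)
  then show ?thesis by simp
qed

lemma has_integral_Pair_const:
  fixes w :: "real \<Rightarrow> 'a::euclidean_space"
  assumes "(w has_integral i) {0..t}" "0 \<le> t"
  shows "((\<lambda>\<tau>. (w \<tau>, c :: real)) has_integral (i, t * c)) {0..t}"
proof -
  have "bounded_linear (\<lambda>v::'a. (v, 0 :: real))"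
    by (intro bounded_linear_Pair bounded_linear_ident bounded_linear_zero)
  from has_integral_linear[OF assms(1) this]
  have "((\<lambda>\<tau>. (w \<tau>, 0 :: real) + (0, c)) has_integral (i, 0) + measure lborel {0..t} *\<^sub>R (0, c)) {0..t}"
    by (intro has_integral_add has_integral_const_real) (simp add: o_def)
  then show ?thesis using \<open>0 \<le> t\<close> by simp
qed

text \<open>Time is adjoined to the state as a component of velocity \<open>1\<close>. Continuous partial derivatives give a total
  derivative on \<open>UNIV \<times> {0..T}\<close>, one-sided at the ends of the time interval.\<close>

lemma caratheodory_chain_rule_time_dependent:
  fixes V :: "'a::euclidean_space \<Rightarrow> real \<Rightarrow> real" and \<xi> w :: "real \<Rightarrow> 'a"
  assumes Vt_cont: "continuous_on (UNIV \<times> {0..T}) (\<lambda>(x, t). Vt x t)"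
    and Vx_cont: "continuous_on (UNIV \<times> {0..T}) (\<lambda>(x, t). Vx x t)"
    and Vt: "\<And>x t. t \<in> {0..T} \<Longrightarrow> ((\<lambda>\<tau>. V x \<tau>) has_real_derivative Vt x t) (at t within {0..T})"
    and Vx: "\<And>x t. t \<in> {0..T} \<Longrightarrow> ((\<lambda>\<xi>. V \<xi> t) has_derivative (\<lambda>v. Vx x t \<bullet> v)) (at x)"
    and t: "t \<in> {0..T}" and w: "w absolutely_integrable_on {0..t}"
    and \<xi>: "\<And>\<tau>. \<tau> \<in> {0..t} \<Longrightarrow> (w has_integral \<xi> \<tau> - \<xi> 0) {0..\<tau>}"
  shows "((\<lambda>\<tau>. Vt (\<xi> \<tau>) \<tau> + Vx (\<xi> \<tau>) \<tau> \<bullet> w \<tau>) has_integral V (\<xi> t) t - V (\<xi> 0) 0) {0..t}"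
proof -
  let ?S = "(UNIV :: 'a set) \<times> {0..T}"
  have total: "((\<lambda>(x, t). V x t) has_derivative (\<lambda>(v, \<tau>). Vx x s \<bullet> v + blinfun_scaleR_left (Vt x s) \<tau>))
      (at (x, s) within ?S)" if "s \<in> {0..T}" for x s
  proof (rule has_derivative_partialsI)
    show "((\<lambda>\<tau>. V x \<tau>) has_derivative blinfun_scaleR_left (Vt x s)) (at s within {0..T})"
      if "s \<in> {0..T}" for x s
      using Vt[OF that, of x] by (simp add: has_field_derivative_def mult_commute_abs)
    show "continuous (at (x, s) within ?S) (\<lambda>(x, t). blinfun_scaleR_left (Vt x t))"
      using bounded_linear.continuous_on[OF bounded_linear_blinfun_scaleR_left Vt_cont] that
      by (auto simp: continuous_on_eq_continuous_within case_prod_unfold)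
  qed (use Vx[OF that] that in auto)
  have "((\<lambda>\<tau>. (\<lambda>(x, t). (Vx x t, Vt x t)) (\<xi> \<tau>, \<tau>) \<bullet> (w \<tau>, 1)) has_integral
      (\<lambda>(x, t). V x t) (\<xi> t, t) - (\<lambda>(x, t). V x t) (\<xi> 0, 0)) {0..t}"
  proof (rule caratheodory_chain_rule[where S = ?S])
    show "convex ?S" by (intro convex_Times) auto
    show "((\<lambda>(x, t). V x t) has_derivative (\<lambda>v. (\<lambda>(x, t). (Vx x t, Vt x t)) p \<bullet> v)) (at p within ?S)"
      if "p \<in> ?S" for p
      using total[of "snd p" "fst p"] that by (auto simp: case_prod_unfold inner_prod_def mult.commute)
    show "continuous_on ?S (\<lambda>(x, t). (Vx x t, Vt x t))"
      using Vt_cont Vx_cont unfolding split_beta by (intro continuous_intros)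
    show "((\<lambda>\<tau>. (w \<tau>, 1)) has_integral (\<xi> \<tau>, \<tau>) - (\<xi> 0, 0)) {0..\<tau>}" if "\<tau> \<in> {0..t}" for \<tau>
      using has_integral_Pair_const[OF \<xi>[OF that], of 1] that by simp
  qed (use t w absolutely_integrable_on_Pair_const in auto)
  then show ?thesis by (simp add: add.commute)
qed

section \<open>Verification by completing the square\<close>

lemma admissible_state_continuous:
  assumes "admissible f x t \<xi> u" "0 \<le> t"
  shows "continuous_on {0..t} \<xi>"
  using assms by (intro continuous_on_indefinite_integral[where w = "\<lambda>\<tau>. f (\<xi> \<tau>) + u \<tau>"])
    (auto simp: admissible_def)

text \<open>With \<open>p = \<nabla>V\<close> and weight \<open>M\<close>, the Hamilton--Jacobi equation turns the derivative \<open>Vt + p \<bullet> (f + u)\<close> of \<open>V\<close> along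
  the trajectory into \<open>l/2 + p \<bullet> u - (p \<bullet> M\<^sup>-\<^sup>1 p)/2\<close>, and the last two terms are half of
  \<open>u \<bullet> M u - w \<bullet> M w\<close> for the deviation \<open>w = u - M\<^sup>-\<^sup>1 p\<close> from the feedback.\<close>

lemma completion_of_squares_along_trajectory:
  fixes V :: "real^'n \<Rightarrow> real \<Rightarrow> real" and M :: "real^'n \<Rightarrow> real^'n^'n"
  assumes Vt_cont: "continuous_on (UNIV \<times> {0..T}) (\<lambda>(x, t). Vt x t)"
    and Vx_cont: "continuous_on (UNIV \<times> {0..T}) (\<lambda>(x, t). Vx x t)"
    and Vt: "\<And>x t. t \<in> {0..T} \<Longrightarrow> ((\<lambda>\<tau>. V x \<tau>) has_real_derivative Vt x t) (at t within {0..T})"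
    and Vx: "\<And>x t. t \<in> {0..T} \<Longrightarrow> ((\<lambda>\<xi>. V \<xi> t) has_derivative (\<lambda>v. Vx x t \<bullet> v)) (at x)"
    and HJ: "\<And>x t. t \<in> {0..T} \<Longrightarrow>
      Vt x t + Vx x t \<bullet> f x + 1/2 * quad_form (matrix_inv (M x)) (Vx x t) - 1/2 * l x t = 0"
    and M: "\<And>x. pos_def (M x)" and f: "continuous_on UNIV f"
    and t: "t \<in> {0..T}" and adm: "admissible f x t \<xi> u"
  shows "((\<lambda>\<tau>. quad_form (M (\<xi> \<tau>)) (u \<tau>) + l (\<xi> \<tau>) \<tau>
      - quad_form (M (\<xi> \<tau>)) (u \<tau> - matrix_inv (M (\<xi> \<tau>)) *v Vx (\<xi> \<tau>) \<tau>))
    has_integral 2 * (V x t - V (\<xi> 0) 0)) {0..t}"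
proof -
  have \<xi>: "continuous_on {0..t} \<xi>" using adm t by (intro admissible_state_continuous) auto
  have "continuous_on {0..t} (\<lambda>\<tau>. f (\<xi> \<tau>))" by (rule continuous_on_compose2[OF f \<xi>]) simp
  then have "(\<lambda>\<tau>. f (\<xi> \<tau>) + u \<tau>) absolutely_integrable_on {0..t}"
    using adm by (intro set_integral_add(1)[OF absolutely_integrable_continuous_real]) (auto simp: admissible_def)
  then have "((\<lambda>\<tau>. Vt (\<xi> \<tau>) \<tau> + Vx (\<xi> \<tau>) \<tau> \<bullet> (f (\<xi> \<tau>) + u \<tau>)) has_integral V (\<xi> t) t - V (\<xi> 0) 0) {0..t}"
    using adm by (intro caratheodory_chain_rule_time_dependent[OF Vt_cont Vx_cont Vt Vx t]) (auto simp: admissible_def)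
  from has_integral_mult_right[OF this, of 2]
  have "((\<lambda>\<tau>. 2 * (Vt (\<xi> \<tau>) \<tau> + Vx (\<xi> \<tau>) \<tau> \<bullet> (f (\<xi> \<tau>) + u \<tau>))) has_integral
      2 * (V x t - V (\<xi> 0) 0)) {0..t}"
    using adm by (simp add: admissible_def)
  moreover have "2 * (Vt z \<tau> + Vx z \<tau> \<bullet> (f z + v)) = quad_form (M z) v + l z \<tau>
      - quad_form (M z) (v - matrix_inv (M z) *v Vx z \<tau>)" if "\<tau> \<in> {0..T}" for z v \<tau>
  proof -
    have "quad_form (M z) (v - matrix_inv (M z) *v Vx z \<tau>)
        = quad_form (M z) v - 2 * (v \<bullet> Vx z \<tau>) + quad_form (matrix_inv (M z)) (Vx z \<tau>)"
      using M[of z] by (subst quad_form_diff)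
        (auto simp: pos_def_def quad_form_def matrix_inv_inverse_vector pos_def_invertible inner_commute)
    with HJ[OF that, of z] show ?thesis
      by (simp add: inner_add_right inner_commute)
  qed
  ultimately show ?thesis
    using t by (subst has_integral_cong) (auto intro!: sym)
qed

text \<open>A square integrable control has finite energy for every continuous weight; otherwise the integral in the
  cost would take the default value \<open>0\<close> and the comparison of costs would be meaningless.\<close>

lemma quad_form_control_integrable:
  fixes u :: "real \<Rightarrow> real^'n"
  assumes M: "continuous_on {0..t} M"
    and u: "u absolutely_integrable_on {0..t}" "(\<lambda>\<tau>. (norm (u \<tau>))\<^sup>2) absolutely_integrable_on {0..t}"
  shows "(\<lambda>\<tau>. quad_form (M \<tau>) (u \<tau>)) integrable_on {0..t}"
proof -
  obtain c where c: "c > 0" "\<And>A v. norm ((A :: real^'n^'n) *v (v :: real^'n)) \<le> norm A * norm v * c"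
    using mv.pos_bounded by blast
  obtain B where B: "\<And>\<tau>. \<tau> \<in> {0..t} \<Longrightarrow> norm (M \<tau>) \<le> B"
    using continuous_function_bounded[OF M] by blast
  show ?thesis
  proof (rule measurable_bounded_by_integrable_imp_integrable)
    show "(\<lambda>\<tau>. quad_form (M \<tau>) (u \<tau>)) \<in> borel_measurable (lebesgue_on {0..t})"
    proof (rule borel_measurable_continuous_Pair[where H = quad_form])
      show "M \<in> borel_measurable (lebesgue_on {0..t})"
        using M by (intro continuous_imp_measurable_on_sets_lebesgue) auto
      show "u \<in> borel_measurable (lebesgue_on {0..t})"
        using u(1) by (simp add: absolutely_integrable_measurable)
    qed (intro continuous_on_quad_form continuous_intros)
    show "(\<lambda>\<tau>. B * c * (norm (u \<tau>))\<^sup>2) integrable_on {0..t}"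
      using u(2) by (intro integrable_on_mult_right) (simp add: absolutely_integrable_on_def)
    fix \<tau> assume \<tau>: "\<tau> \<in> {0..t}"
    have "norm (quad_form (M \<tau>) (u \<tau>)) \<le> norm (u \<tau>) * norm (M \<tau> *v u \<tau>)"
      unfolding quad_form_def real_norm_def by (rule Cauchy_Schwarz_ineq2)
    also have "\<dots> \<le> norm (u \<tau>) * (norm (M \<tau>) * norm (u \<tau>) * c)"
      by (intro mult_left_mono c) auto
    also have "\<dots> \<le> norm (u \<tau>) * (B * norm (u \<tau>) * c)"
      using B[OF \<tau>] c(1) by (intro mult_left_mono mult_right_mono) auto
    finally show "norm (quad_form (M \<tau>) (u \<tau>)) \<le> B * c * (norm (u \<tau>))\<^sup>2"
      by (simp add: power2_eq_square algebra_simps)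
  qed auto
qed

section \<open>The equations in Koopman coordinates\<close>

lemma principal_eigenfunctionsD:
  assumes "principal_eigenfunctions f \<Lambda> \<Phi>"
  shows "(\<Phi> has_derivative (\<lambda>v. jacobian \<Phi> (at x) *v v)) (at x)"
    and "continuous_on UNIV (\<lambda>x. jacobian \<Phi> (at x))"
    and "continuous_on UNIV \<Phi>"
    and "invertible (jacobian \<Phi> (at x))"
    and "jacobian \<Phi> (at x) *v f x = \<Lambda> *v \<Phi> x"
    and "bij \<Phi>"
proof -
  have diff: "\<Phi> differentiable (at x)" for x
    using assms by (auto simp: principal_eigenfunctions_def)
  have cont: "continuous_on UNIV (\<lambda>x. frechet_derivative \<Phi> (at x) v)" for v
    using assms by (auto simp: principal_eigenfunctions_def)
  show "(\<Phi> has_derivative (\<lambda>v. jacobian \<Phi> (at x) *v v)) (at x)"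
    using diff jacobian_works by blast
  show "continuous_on UNIV (\<lambda>x. jacobian \<Phi> (at x))"
    unfolding jacobian_def matrix_def by (intro continuous_on_vec_lambda continuous_intros cont)
  show "continuous_on UNIV \<Phi>"
    using diff by (simp add: continuous_at_imp_continuous_on differentiable_imp_continuous_within)
qed (use assms in \<open>auto simp: principal_eigenfunctions_def\<close>)

text \<open>In the coordinates \<open>\<Phi>\<close> the feedback \<open>R1\<^sup>-\<^sup>1 \<nabla>V\<close> is the linear feedback \<open>R p\<close>: the two factors \<open>D\<Phi>\<^sup>T\<close> cancel.\<close>

lemma matrix_inv_R1_gradient:
  assumes R: "invertible R" and J: "invertible (jacobian \<Phi> (at x))"
  shows "matrix_inv (R1 \<Phi> R x) *v (transpose (jacobian \<Phi> (at x)) *v p)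
    = matrix_inv (jacobian \<Phi> (at x)) *v (R *v p)"
proof -
  let ?J = "jacobian \<Phi> (at x)"
  have J': "invertible (transpose ?J)" using J by (rule transpose_invertible)
  have R': "invertible (matrix_inv R)" using R matrix_inv_inverse[OF R] unfolding invertible_def by blast
  have inv: "invertible (R1 \<Phi> R x)"
    unfolding R1_def using J J' R' by (intro invertible_mult)
  have "R1 \<Phi> R x *v (matrix_inv ?J *v (R *v p)) = transpose ?J *v p"
    unfolding R1_def
    by (simp only: matrix_vector_mul_assoc[symmetric] matrix_inv_inverse_vector[OF J] matrix_inv_inverse_vector[OF R])
  then show ?thesis by (metis matrix_inv_inverse_vector(2)[OF inv])
qed

text \<open>The Hamilton--Jacobi equation at one point: \<open>z\<close> is \<open>\<Phi> x\<close>, \<open>v\<close> is \<open>f x\<close>, \<open>J\<close> is the Jacobian of \<open>\<Phi>\<close> at \<open>x\<close> and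
  \<open>Qi\<close> is \<open>Q\<^sup>-\<^sup>1\<close>. The eigenfunction equation \<open>J v = L z\<close> makes every term a polynomial of degree at most two
  in \<open>z\<close>, and each degree cancels by one of the coefficient equations.\<close>

lemma koopman_hamilton_jacobi:
  fixes z s s' v :: "real^'n" and P P' L R J :: "real^'n^'n" and Qi :: "real^'p^'p"
  assumes P: "transpose P = P" and Qi: "transpose Qi = Qi"
    and P': "P' = transpose C ** Qi ** C - transpose L ** P - P ** L - P ** R ** P"
    and s': "s' = - (transpose L *v s) - (P ** R) *v s - (transpose C ** Qi) *v y"
    and r': "r' = 1/2 * quad_form Qi y - 1/2 * quad_form R s"
    and R: "transpose R = R" and J: "J *v v = L *v z"
  shows "(1/2 * quad_form P' z + s' \<bullet> z + r') + (transpose J *v (P *v z + s)) \<bullet> v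
      + 1/2 * quad_form R (P *v z + s) - 1/2 * quad_form Qi (y - C *v z) = 0"
proof -
  have sym: "a \<bullet> (P *v b) = (P *v a) \<bullet> b" "a \<bullet> (R *v b) = (R *v a) \<bullet> b" for a b
    using inner_matrix_vector_transpose[of a P b] inner_matrix_vector_transpose[of a R b] P R by simp_all
  have adj: "a \<bullet> (transpose L *v b) = (L *v a) \<bullet> b" for a b
    using inner_matrix_vector_transpose[of a "transpose L" b] by simp
  have adjC: "a \<bullet> (transpose C *v b) = (C *v a) \<bullet> b" for a b
    using inner_matrix_vector_transpose[of a "transpose C" b] by simp
  have adjJ: "(transpose J *v a) \<bullet> v = a \<bullet> (L *v z)" for a
    using inner_matrix_vector_transpose[of a J v] J by simp
  have 1: "quad_form P' z = quad_form Qi (C *v z) - 2 * ((L *v z) \<bullet> (P *v z)) - quad_form R (P *v z)"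
    unfolding P' quad_form_def
    by (simp only: mv.diff_left matrix_vector_mul_assoc[symmetric] inner_diff_right adj adjC
        sym(1)[of z] inner_commute[of "P *v z" "L *v z"])
  have "z \<bullet> s' = - (s \<bullet> (L *v z)) - (P *v z) \<bullet> (R *v s) - (C *v z) \<bullet> (Qi *v y)"
    unfolding s'
    by (simp only: matrix_vector_mul_assoc[symmetric] inner_diff_right inner_minus_right adj adjC
        sym(1)[of z] inner_commute[of "L *v z" s])
  then have 2: "s' \<bullet> z = - (s \<bullet> (L *v z)) - (P *v z) \<bullet> (R *v s) - (C *v z) \<bullet> (Qi *v y)"
    by (simp only: inner_commute[of s'])
  have 3: "quad_form R (P *v z + s) = quad_form R (P *v z) + 2 * ((P *v z) \<bullet> (R *v s)) + quad_form R s"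
    unfolding quad_form_def
    by (simp add: mv.add_right inner_add_left inner_add_right sym(2)[of s "P *v z"]
        inner_commute[of "R *v s"])
  have 4: "quad_form Qi (y - C *v z) = quad_form Qi y - 2 * ((C *v z) \<bullet> (Qi *v y)) + quad_form Qi (C *v z)"
    using quad_form_diff[OF Qi, of y "C *v z"] inner_matrix_vector_transpose[of y Qi "C *v z"]
    unfolding Qi inner_commute[of "Qi *v y"] by simp
  show ?thesis
    unfolding 1 2 3 4 adjJ r' by (simp add: inner_add_left inner_commute algebra_simps)
qed

section \<open>Existence and positivity of the coefficients\<close>

lemma coefficient_solutionD:
  assumes "coefficient_solution \<Lambda> C \<Phi> R Q \<Sigma> \<mu> y T P s r"
  shows "riccati_solution \<Lambda> (transpose C ** matrix_inv Q ** C) R T P"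
    and "\<And>t. t \<in> {0..T} \<Longrightarrow> (s has_vector_derivative
      - (transpose \<Lambda> *v s t) - (P t ** R) *v s t - (transpose C ** matrix_inv Q) *v y t) (at t within {0..T})"
    and "\<And>t. t \<in> {0..T} \<Longrightarrow> (r has_real_derivative
      1/2 * quad_form (matrix_inv Q) (y t) - 1/2 * quad_form R (s t)) (at t within {0..T})"
    and "P 0 = matrix_inv \<Sigma>" "s 0 = - (matrix_inv \<Sigma> *v \<Phi> \<mu>)"
    and "r 0 = 1/2 * quad_form (matrix_inv \<Sigma>) (\<Phi> \<mu>)"
proof -
  obtain P' s' r' where ode: "\<forall>t\<in>{0..T}. (P has_vector_derivative P' t) (at t within {0..T}) \<and>
      (s has_vector_derivative s' t) (at t within {0..T}) \<and>
      (r has_real_derivative r' t) (at t within {0..T}) \<and>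
      P' t + transpose \<Lambda> ** P t + P t ** \<Lambda> + P t ** R ** P t - transpose C ** matrix_inv Q ** C = 0 \<and>
      s' t + transpose \<Lambda> *v s t + (P t ** R) *v s t + (transpose C ** matrix_inv Q) *v y t = 0 \<and>
      r' t + 1/2 * quad_form R (s t) - 1/2 * quad_form (matrix_inv Q) (y t) = 0"
    using assms unfolding coefficient_solution_def by blast
  have "P' t = transpose C ** matrix_inv Q ** C - transpose \<Lambda> ** P t - P t ** \<Lambda> - P t ** R ** P t"
    "s' t = - (transpose \<Lambda> *v s t) - (P t ** R) *v s t - (transpose C ** matrix_inv Q) *v y t"
    "r' t = 1/2 * quad_form (matrix_inv Q) (y t) - 1/2 * quad_form R (s t)" if "t \<in> {0..T}" for t
    using bspec[OF ode that] by (auto simp: algebra_simps add_eq_0_iff2)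
  then show "riccati_solution \<Lambda> (transpose C ** matrix_inv Q ** C) R T P"
    "\<And>t. t \<in> {0..T} \<Longrightarrow> (s has_vector_derivative
      - (transpose \<Lambda> *v s t) - (P t ** R) *v s t - (transpose C ** matrix_inv Q) *v y t) (at t within {0..T})"
    "\<And>t. t \<in> {0..T} \<Longrightarrow> (r has_real_derivative
      1/2 * quad_form (matrix_inv Q) (y t) - 1/2 * quad_form R (s t)) (at t within {0..T})"
    using ode unfolding riccati_solution_def by auto
qed (use assms in \<open>auto simp: coefficient_solution_def\<close>)

lemma coefficient_solution_pos_def:
  assumes coeff: "coefficient_solution \<Lambda> C \<Phi> R Q \<Sigma> \<mu> y T P s r"
    and "pos_def R" "pos_def Q" "pos_def \<Sigma>" and t: "t \<in> {0..T}"
  shows "pos_def (P t)"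
proof -
  obtain P0 where P0: "riccati_solution \<Lambda> (transpose C ** matrix_inv Q ** C) R T P0" "P0 0 = matrix_inv \<Sigma>"
    and pos: "pos_def (P0 t)"
    using riccati_solution_exists[OF _ \<open>pos_def R\<close> output_weight_psd[OF \<open>pos_def Q\<close>]
        pos_def_matrix_inv[OF \<open>pos_def \<Sigma>\<close>], of T \<Lambda> C] t by auto
  show ?thesis
    using riccati_solution_unique[OF coefficient_solutionD(1)[OF coeff] P0(1) _ t]
      coefficient_solutionD(4)[OF coeff] P0(2) pos by simp
qed

text \<open>Once \<open>P\<close> is known, the equation for \<open>s\<close> is linear and \<open>r\<close> is an integral of known functions.\<close>

lemma coefficient_solution_exists:
  fixes C :: "real^'n^'p"
  assumes "pos_def R" "pos_def Q" "pos_def \<Sigma>" "0 \<le> T" and y: "continuous_on {0..T} y"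
  obtains P s r where "coefficient_solution \<Lambda> C \<Phi> R Q \<Sigma> \<mu> y T P s r"
proof -
  obtain P where P: "riccati_solution \<Lambda> (transpose C ** matrix_inv Q ** C) R T P" "P 0 = matrix_inv \<Sigma>"
    using riccati_solution_exists[OF \<open>0 \<le> T\<close> \<open>pos_def R\<close> output_weight_psd[OF \<open>pos_def Q\<close>]
        pos_def_matrix_inv[OF \<open>pos_def \<Sigma>\<close>]] by metis
  note P_cont = riccati_solution_continuous[OF P(1)]
  obtain s where s0: "s 0 = - (matrix_inv \<Sigma> *v \<Phi> \<mu>)"
    and s: "\<And>t. t \<in> {0..T} \<Longrightarrow> (s has_vector_derivative (- transpose \<Lambda> - P t ** R) *v s t
        + - ((transpose C ** matrix_inv Q) *v y t)) (at t within {0..T})"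
    by (rule linear_ode_solution_exists[OF \<open>0 \<le> T\<close>, of "\<lambda>t. - transpose \<Lambda> - P t ** R"
        "\<lambda>t. - ((transpose C ** matrix_inv Q) *v y t)" "- (matrix_inv \<Sigma> *v \<Phi> \<mu>)"])
      (intro continuous_on_minus continuous_on_diff mv.continuous_on mm.continuous_on continuous_on_const P_cont y | rule that)+
  have s_cont: "continuous_on {0..T} s" using s by (rule continuous_on_if_has_vector_derivative)
  define r' where "r' t = 1/2 * quad_form (matrix_inv Q) (y t) - 1/2 * quad_form R (s t)" for t
  have r': "continuous_on {0..T} r'"
    unfolding r'_def by (intro continuous_intros continuous_on_quad_form y s_cont)
  define r where "r t = 1/2 * quad_form (matrix_inv \<Sigma>) (\<Phi> \<mu>) + integral {0..t} r'" for t
  have r: "(r has_real_derivative r' t) (at t within {0..T})" if "t \<in> {0..T}" for t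
    unfolding r_def has_real_derivative_iff_has_vector_derivative
    using integral_has_vector_derivative[OF r' that] by (auto intro!: derivative_eq_intros)
  have "coefficient_solution \<Lambda> C \<Phi> R Q \<Sigma> \<mu> y T P s r"
    unfolding coefficient_solution_def
  proof (intro conjI exI ballI)
    fix t assume t: "t \<in> {0..T}"
    show "(P has_vector_derivative transpose C ** matrix_inv Q ** C - transpose \<Lambda> ** P t - P t ** \<Lambda> - P t ** R ** P t)
        (at t within {0..T})" using P(1) t by (auto simp: riccati_solution_def)
  qed (use P(2) s0 s r in \<open>auto simp: r_def r'_def mv.diff_left mv.minus_left algebra_simps\<close>)
  then show thesis by (rule that)
qed

section \<open>Optimality of the quadratic value function\<close>

text \<open>The coefficients \<open>P\<close>, \<open>s\<close>, \<open>r\<close> are parameters rather than chosen solutions, so that the results apply to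
  every solution of the coefficient equations.\<close>

locale koopman_observer =
  fixes f \<Phi> :: "real^'n \<Rightarrow> real^'n" and h :: "real^'n \<Rightarrow> real^'p"
    and \<Lambda> R \<Sigma> :: "real^'n^'n" and Q :: "real^'p^'p" and C :: "real^'n^'p"
    and \<mu> :: "real^'n" and T :: real and y :: "real \<Rightarrow> real^'p"
    and P :: "real \<Rightarrow> real^'n^'n" and s :: "real \<Rightarrow> real^'n" and r :: "real \<Rightarrow> real"
  assumes f_cont: "continuous_on UNIV f"
    and R: "pos_def R" and Q: "pos_def Q" and \<Sigma>: "pos_def \<Sigma>"
    and y_cont: "continuous_on {0..T} y"
    and eigenfunctions: "principal_eigenfunctions f \<Lambda> \<Phi>"
    and output_in_span: "h x = C *v \<Phi> x"
    and coeff: "coefficient_solution \<Lambda> C \<Phi> R Q \<Sigma> \<mu> y T P s r"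
begin

abbreviation J :: "real^'n \<Rightarrow> real^'n^'n" where "J x \<equiv> jacobian \<Phi> (at x)"

abbreviation V :: "real^'n \<Rightarrow> real \<Rightarrow> real" where "V \<equiv> V_Phi \<Phi> P s r"

abbreviation M :: "real^'n \<Rightarrow> real^'n^'n" where "M \<equiv> R1 \<Phi> R"

text \<open>The right-hand sides of the coefficient equations are used as derivatives because, unlike arbitrary
  derivatives, they are visibly continuous in \<open>t\<close>.\<close>

definition P' :: "real \<Rightarrow> real^'n^'n" where
  "P' t = transpose C ** matrix_inv Q ** C - transpose \<Lambda> ** P t - P t ** \<Lambda> - P t ** R ** P t"

definition s' :: "real \<Rightarrow> real^'n" where
  "s' t = - (transpose \<Lambda> *v s t) - (P t ** R) *v s t - (transpose C ** matrix_inv Q) *v y t"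

definition r' :: "real \<Rightarrow> real" where
  "r' t = 1/2 * quad_form (matrix_inv Q) (y t) - 1/2 * quad_form R (s t)"

text \<open>The gradient of the value function with respect to \<open>z = \<Phi> x\<close>.\<close>

definition costate :: "real^'n \<Rightarrow> real \<Rightarrow> real^'n" where
  "costate x t = P t *v \<Phi> x + s t"

definition Vx :: "real^'n \<Rightarrow> real \<Rightarrow> real^'n" where
  "Vx x t = transpose (J x) *v costate x t"

definition Vt :: "real^'n \<Rightarrow> real \<Rightarrow> real" where
  "Vt x t = 1/2 * quad_form (P' t) (\<Phi> x) + s' t \<bullet> \<Phi> x + r' t"

lemmas P_riccati = coefficient_solutionD(1)[OF coeff]
lemmas P_derivative = P_riccati[unfolded riccati_solution_def, rule_format, folded P'_def]
lemmas s_derivative = coefficient_solutionD(2)[OF coeff, folded s'_def]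
lemmas r_derivative = coefficient_solutionD(3)[OF coeff, folded r'_def]
lemmas P_cont = riccati_solution_continuous[OF P_riccati]
lemmas s_cont = continuous_on_if_has_vector_derivative[OF s_derivative]

lemma R_sym: "transpose R = R" and R_inv: "invertible R" and \<Sigma>_inv_sym: "transpose (matrix_inv \<Sigma>) = matrix_inv \<Sigma>"
  and Q_inv_sym: "transpose (matrix_inv Q) = matrix_inv Q"
  using R Q \<Sigma> pos_def_invertible pos_def_matrix_inv by (auto simp: pos_def_def)

lemma P_pos_def: "t \<in> {0..T} \<Longrightarrow> pos_def (P t)"
  by (rule coefficient_solution_pos_def[OF coeff R Q \<Sigma>])

lemma P_sym: "t \<in> {0..T} \<Longrightarrow> transpose (P t) = P t"
  using P_pos_def by (simp add: pos_def_def)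

lemmas \<Phi>_derivative = principal_eigenfunctionsD(1)[OF eigenfunctions]
lemmas J_cont = principal_eigenfunctionsD(2)[OF eigenfunctions]
lemmas \<Phi>_cont = principal_eigenfunctionsD(3)[OF eigenfunctions]
lemmas J_inv = principal_eigenfunctionsD(4)[OF eigenfunctions]
lemmas J_f = principal_eigenfunctionsD(5)[OF eigenfunctions]
lemmas \<Phi>_bij = principal_eigenfunctionsD(6)[OF eigenfunctions]

lemma M_pos_def: "pos_def (M x)"
  unfolding R1_def by (intro pos_def_congruence pos_def_matrix_inv R J_inv)

lemma M_cont: "continuous_on UNIV M"
  unfolding R1_def[abs_def]
  by (intro mm.continuous_on bounded_linear.continuous_on[OF bounded_linear_transpose] J_cont continuous_on_const)

lemma Vx_derivative:
  assumes "t \<in> {0..T}"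
  shows "((\<lambda>\<xi>. V \<xi> t) has_derivative (\<lambda>v. Vx x t \<bullet> v)) (at x)"
proof -
  have "((\<lambda>\<xi>. 1/2 * (\<Phi> \<xi> \<bullet> (P t *v \<Phi> \<xi>)) + s t \<bullet> \<Phi> \<xi> + r t) has_derivative
      (\<lambda>v. 1/2 * (\<Phi> x \<bullet> (P t *v (J x *v v)) + (J x *v v) \<bullet> (P t *v \<Phi> x)) + s t \<bullet> (J x *v v) + 0)) (at x)"
    by (intro has_derivative_add has_derivative_mult_right has_derivative_inner has_derivative_inner_right
        bounded_linear.has_derivative[OF mv.bounded_linear_right] \<Phi>_derivative has_derivative_const)
  moreover have "1/2 * (\<Phi> x \<bullet> (P t *v w) + w \<bullet> (P t *v \<Phi> x)) + s t \<bullet> w + 0 = costate x t \<bullet> w" for w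
    using inner_matrix_vector_transpose[of "\<Phi> x" "P t" w, unfolded P_sym[OF assms]]
    by (simp add: costate_def inner_add_left inner_commute[of w])
  moreover have "costate x t \<bullet> (J x *v v) = Vx x t \<bullet> v" for v
    unfolding Vx_def by (rule inner_matrix_vector_transpose)
  ultimately show ?thesis by (simp add: V_Phi_def quad_form_def)
qed

lemma Vt_derivative:
  assumes "t \<in> {0..T}"
  shows "((\<lambda>\<tau>. V x \<tau>) has_real_derivative Vt x t) (at t within {0..T})"
proof -
  have "((\<lambda>\<tau>. 1/2 * (\<Phi> x \<bullet> (P \<tau> *v \<Phi> x)) + s \<tau> \<bullet> \<Phi> x + r \<tau>) has_vector_derivative
      1/2 * (\<Phi> x \<bullet> (P' t *v \<Phi> x)) + s' t \<bullet> \<Phi> x + r' t) (at t within {0..T})"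
    using r_derivative[OF assms]
    by (intro has_vector_derivative_add
        bounded_linear.has_vector_derivative[OF bounded_linear_mult_right]
        bounded_linear.has_vector_derivative[OF bounded_linear_inner_right]
        bounded_linear.has_vector_derivative[OF bounded_linear_inner_left]
        bounded_linear.has_vector_derivative[OF mv.bounded_linear_left]
        P_derivative[OF assms] s_derivative[OF assms])
      (simp add: has_real_derivative_iff_has_vector_derivative)
  then show ?thesis
    by (simp add: has_real_derivative_iff_has_vector_derivative V_Phi_def quad_form_def Vt_def)
qed

lemma costate_cont: "continuous_on (UNIV \<times> {0..T}) (\<lambda>p. costate (fst p) (snd p))"
  unfolding costate_def
  by (intro continuous_on_add mv.continuous_on continuous_on_compose2[OF P_cont] continuous_on_compose2[OF s_cont]
      continuous_on_compose2[OF \<Phi>_cont] continuous_on_fst continuous_on_snd continuous_on_id) auto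

lemma Vx_cont: "continuous_on (UNIV \<times> {0..T}) (\<lambda>(x, t). Vx x t)"
  unfolding Vx_def case_prod_unfold
  by (intro mv.continuous_on costate_cont bounded_linear.continuous_on[OF bounded_linear_transpose]
      continuous_on_compose2[OF J_cont] continuous_on_fst continuous_on_id) auto

lemma Vt_cont: "continuous_on (UNIV \<times> {0..T}) (\<lambda>(x, t). Vt x t)"
proof -
  have "continuous_on {0..T} P'" "continuous_on {0..T} s'"
    unfolding P'_def[abs_def] s'_def[abs_def]
    by (intro continuous_on_diff continuous_on_minus mm.continuous_on mv.continuous_on continuous_on_const
        P_cont s_cont y_cont)+
  moreover have "continuous_on {0..T} r'"
    unfolding r'_def[abs_def] by (intro continuous_intros continuous_on_quad_form y_cont s_cont)
  ultimately show ?thesis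
    unfolding Vt_def case_prod_unfold
    by (intro continuous_on_add continuous_on_mult continuous_on_quad_form continuous_on_inner continuous_on_const
        continuous_on_compose2[OF _ continuous_on_snd[OF continuous_on_id]]
        continuous_on_compose2[OF \<Phi>_cont continuous_on_fst[OF continuous_on_id]]) auto
qed

lemma feedback_eq: "matrix_inv (M x) *v Vx x t = matrix_inv (J x) *v (R *v costate x t)"
  unfolding Vx_def by (rule matrix_inv_R1_gradient[OF R_inv J_inv])

lemma hamilton_jacobi:
  assumes "t \<in> {0..T}"
  shows "Vt x t + Vx x t \<bullet> f x + 1/2 * quad_form (matrix_inv (M x)) (Vx x t)
    - 1/2 * quad_form (matrix_inv Q) (y t - h x) = 0"
proof -
  have "quad_form (matrix_inv (M x)) (Vx x t) = costate x t \<bullet> (J x *v (matrix_inv (J x) *v (R *v costate x t)))"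
    unfolding quad_form_def feedback_eq unfolding Vx_def by (rule inner_matrix_vector_transpose[symmetric])
  also have "\<dots> = quad_form R (costate x t)"
    by (simp add: matrix_inv_inverse_vector(1)[OF J_inv] quad_form_def)
  finally show ?thesis
    using koopman_hamilton_jacobi[OF P_sym[OF assms] Q_inv_sym P'_def s'_def r'_def R_sym J_f]
    unfolding output_in_span by (simp add: Vt_def Vx_def costate_def)
qed

lemma V_initial: "V x 0 = initial_cost \<Phi> \<Sigma> \<mu> x"
  using inner_matrix_vector_transpose[of "\<Phi> \<mu>" "matrix_inv \<Sigma>" "\<Phi> x", unfolded \<Sigma>_inv_sym]
  by (simp add: V_Phi_def initial_cost_def coefficient_solutionD(4-6)[OF coeff] quad_form_diff[OF \<Sigma>_inv_sym]
      inner_commute)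

abbreviation running_cost :: "(real \<Rightarrow> real^'n) \<Rightarrow> (real \<Rightarrow> real^'n) \<Rightarrow> real \<Rightarrow> real" where
  "running_cost \<xi> u \<tau> \<equiv> quad_form (M (\<xi> \<tau>)) (u \<tau>) + quad_form (matrix_inv Q) (y \<tau> - h (\<xi> \<tau>))"

lemma running_cost_integrable:
  assumes adm: "admissible f x t \<xi> u" and t: "t \<in> {0..T}"
  shows "running_cost \<xi> u integrable_on {0..t}"
proof (intro integrable_add)
  have \<xi>: "continuous_on {0..t} \<xi>" using adm t by (intro admissible_state_continuous) auto
  show "(\<lambda>\<tau>. quad_form (M (\<xi> \<tau>)) (u \<tau>)) integrable_on {0..t}"
    using adm by (intro quad_form_control_integrable continuous_on_compose2[OF M_cont \<xi>]) (auto simp: admissible_def)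
  show "(\<lambda>\<tau>. quad_form (matrix_inv Q) (y \<tau> - h (\<xi> \<tau>))) integrable_on {0..t}"
    unfolding output_in_span using t
    by (intro integrable_continuous_interval continuous_on_quad_form continuous_on_const continuous_on_diff
        mv.continuous_on continuous_on_compose2[OF \<Phi>_cont \<xi>] continuous_on_subset[OF y_cont]) auto
qed

lemma running_cost_completed_square:
  assumes adm: "admissible f x t \<xi> u" and t: "t \<in> {0..T}"
  shows "((\<lambda>\<tau>. running_cost \<xi> u \<tau> - quad_form (M (\<xi> \<tau>)) (u \<tau> - matrix_inv (M (\<xi> \<tau>)) *v Vx (\<xi> \<tau>) \<tau>))
    has_integral 2 * (V x t - V (\<xi> 0) 0)) {0..t}"
  by (rule completion_of_squares_along_trajectory[where l = "\<lambda>x t. quad_form (matrix_inv Q) (y t - h x)",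
      OF Vt_cont Vx_cont Vt_derivative Vx_derivative hamilton_jacobi M_pos_def f_cont t adm])

lemma value_le_cost:
  assumes adm: "admissible f x t \<xi> u" and t: "t \<in> {0..T}"
  shows "V x t \<le> cost h \<Phi> R Q \<Sigma> \<mu> y t \<xi> u"
proof -
  have "2 * (V x t - V (\<xi> 0) 0) \<le> integral {0..t} (running_cost \<xi> u)"
    by (rule has_integral_le[OF running_cost_completed_square[OF adm t]
          integrable_integral[OF running_cost_integrable[OF adm t]]])
      (simp add: quad_form_nonneg[OF M_pos_def])
  then show ?thesis using t by (simp add: cost_def V_initial)
qed

lemma value_eq_cost_of_feedback:
  assumes adm: "admissible f x t \<xi> u" and t: "t \<in> {0..T}"
    and feedback: "\<And>\<tau>. \<tau> \<in> {0..t} \<Longrightarrow> u \<tau> = matrix_inv (M (\<xi> \<tau>)) *v Vx (\<xi> \<tau>) \<tau>"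
  shows "cost h \<Phi> R Q \<Sigma> \<mu> y t \<xi> u = V x t"
proof -
  have "(running_cost \<xi> u has_integral 2 * (V x t - V (\<xi> 0) 0)) {0..t}"
    by (rule has_integral_eq[OF _ running_cost_completed_square[OF adm t]])
      (simp add: feedback quad_form_def)
  then show ?thesis using t by (simp add: cost_def V_initial integral_unique diff_divide_distrib)
qed

text \<open>The closed loop is linear in \<open>z\<close>: \<open>z' = \<Lambda> z + R (P z + s)\<close>. Its solution with \<open>z t = \<Phi> x\<close> is pulled back to
  the state space by the inverse of \<open>\<Phi>\<close>, which is differentiable by the inverse function theorem. The resulting
  control is continuous, hence admissible.\<close>

lemma feedback_trajectory_exists:
  assumes t: "t \<in> {0..T}"
  obtains \<xi> u where "admissible f x t \<xi> u"
    "\<And>\<tau>. \<tau> \<in> {0..t} \<Longrightarrow> u \<tau> = matrix_inv (M (\<xi> \<tau>)) *v Vx (\<xi> \<tau>) \<tau>"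
proof -
  have sub: "{0..t} \<subseteq> {0..T}" using t by auto
  obtain z where zt: "z t = \<Phi> x" and z: "\<And>\<tau>. \<tau> \<in> {0..t} \<Longrightarrow>
      (z has_vector_derivative (\<Lambda> + R ** P \<tau>) *v z \<tau> + R *v s \<tau>) (at \<tau> within {0..t})"
  proof (rule linear_ode_terminal_value_solution_exists[of t "\<lambda>\<tau>. \<Lambda> + R ** P \<tau>" "\<lambda>\<tau>. R *v s \<tau>" "\<Phi> x"])
    show "0 \<le> t" using t by simp
    show "continuous_on {0..t} (\<lambda>\<tau>. \<Lambda> + R ** P \<tau>)" "continuous_on {0..t} (\<lambda>\<tau>. R *v s \<tau>)"
      by (intro continuous_on_add mm.continuous_on mv.continuous_on continuous_on_const
          continuous_on_subset[OF P_cont sub] continuous_on_subset[OF s_cont sub])+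
  qed (rule that)
  define \<xi> where "\<xi> \<tau> = inv \<Phi> (z \<tau>)" for \<tau>
  have \<Phi>\<xi>: "\<Phi> (\<xi> \<tau>) = z \<tau>" for \<tau>
    using \<Phi>_bij by (simp add: \<xi>_def bij_is_surj surj_f_inv_f)
  define u where "u \<tau> = matrix_inv (J (\<xi> \<tau>)) *v (R *v (P \<tau> *v z \<tau> + s \<tau>))" for \<tau>
  have u: "u \<tau> = matrix_inv (M (\<xi> \<tau>)) *v Vx (\<xi> \<tau>) \<tau>" for \<tau>
    by (simp add: feedback_eq u_def costate_def \<Phi>\<xi>)
  have inv_derivative: "(inv \<Phi> has_derivative (\<lambda>v. matrix_inv (J a) *v v)) (at (\<Phi> a))" for a
    using \<Phi>_bij
    by (intro has_derivative_inverse_strong[OF open_UNIV UNIV_I \<Phi>_cont _ \<Phi>_derivative])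
      (auto simp: fun_eq_iff matrix_inv_inverse_vector[OF J_inv] bij_is_inj)
  have \<xi>_derivative: "(\<xi> has_vector_derivative f (\<xi> \<tau>) + u \<tau>) (at \<tau> within {0..t})" if "\<tau> \<in> {0..t}" for \<tau>
  proof -
    have "(inv \<Phi> has_derivative (\<lambda>v. matrix_inv (J (\<xi> \<tau>)) *v v)) (at (z \<tau>) within z ` {0..t})"
      using inv_derivative[of "\<xi> \<tau>"] unfolding \<Phi>\<xi> by (rule has_derivative_at_withinI)
    from vector_derivative_diff_chain_within[OF z[OF that] this]
    have "(\<xi> has_vector_derivative matrix_inv (J (\<xi> \<tau>)) *v ((\<Lambda> + R ** P \<tau>) *v z \<tau> + R *v s \<tau>)) (at \<tau> within {0..t})"
      by (simp add: \<xi>_def[abs_def] o_def)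
    also have "(\<Lambda> + R ** P \<tau>) *v z \<tau> + R *v s \<tau> = J (\<xi> \<tau>) *v f (\<xi> \<tau>) + R *v (P \<tau> *v z \<tau> + s \<tau>)"
      by (simp add: J_f \<Phi>\<xi> mv.add_left mv.add_right matrix_vector_mul_assoc)
    finally show ?thesis
      by (simp add: mv.add_right matrix_inv_inverse_vector(2)[OF J_inv] u_def)
  qed
  have \<xi>_cont: "continuous_on {0..t} \<xi>" using \<xi>_derivative by (rule continuous_on_if_has_vector_derivative)
  have z_cont: "continuous_on {0..t} z" using z by (rule continuous_on_if_has_vector_derivative)
  have u_cont: "continuous_on {0..t} u"
    unfolding u_def[abs_def]
    by (intro mv.continuous_on continuous_on_add continuous_on_const continuous_on_matrix_inv J_inv
        continuous_on_compose2[OF J_cont \<xi>_cont] z_cont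
        continuous_on_subset[OF P_cont sub] continuous_on_subset[OF s_cont sub]) auto
  show thesis
  proof (rule that)
    show "admissible f x t \<xi> u"
      unfolding admissible_def
    proof (intro conjI ballI)
      show "u absolutely_integrable_on {0..t}" "(\<lambda>\<tau>. (norm (u \<tau>))\<^sup>2) absolutely_integrable_on {0..t}"
        by (intro absolutely_integrable_continuous_real continuous_intros u_cont)+
      show "\<xi> t = x" using \<Phi>_bij by (simp add: \<xi>_def zt bij_is_inj)
      fix \<tau> assume \<tau>: "\<tau> \<in> {0..t}"
      show "((\<lambda>\<sigma>. f (\<xi> \<sigma>) + u \<sigma>) has_integral \<xi> \<tau> - \<xi> 0) {0..\<tau>}"
        using \<tau> \<xi>_derivative by (intro fundamental_theorem_of_calculus) (auto intro!: has_vector_derivative_subinterval[OF \<xi>_derivative])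
    qed
  qed (rule u)
qed

lemma optimal_value_eq_V_Phi:
  assumes t: "t \<in> {0..T}"
  shows "optimal_value f h \<Phi> R Q \<Sigma> \<mu> y x t = V x t" and "V x t \<in> costs f h \<Phi> R Q \<Sigma> \<mu> y x t"
proof -
  obtain \<xi> u where \<xi>u: "admissible f x t \<xi> u"
    "\<And>\<tau>. \<tau> \<in> {0..t} \<Longrightarrow> u \<tau> = matrix_inv (M (\<xi> \<tau>)) *v Vx (\<xi> \<tau>) \<tau>"
    using feedback_trajectory_exists[OF t] by metis
  show mem: "V x t \<in> costs f h \<Phi> R Q \<Sigma> \<mu> y x t"
    unfolding costs_def using \<xi>u(1) value_eq_cost_of_feedback[OF \<xi>u(1) t \<xi>u(2)] by force
  show "optimal_value f h \<Phi> R Q \<Sigma> \<mu> y x t = V x t"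
    unfolding optimal_value_def
    by (rule cInf_eq_minimum[OF mem]) (use value_le_cost t in \<open>auto simp: costs_def\<close>)
qed

lemma optimal_value_HJ_solution:
  "HJ_solution f h \<Phi> R Q y T (optimal_value f h \<Phi> R Q \<Sigma> \<mu> y)"
  unfolding HJ_solution_def
proof (intro exI conjI allI ballI)
  fix x t assume t: "t \<in> {0..T}"
  show "((\<lambda>\<tau>. optimal_value f h \<Phi> R Q \<Sigma> \<mu> y x \<tau>) has_real_derivative Vt x t) (at t within {0..T})"
    unfolding has_field_derivative_def
    by (rule has_derivative_transform[OF t _ Vt_derivative[OF t, of x, unfolded has_field_derivative_def]])
      (simp add: optimal_value_eq_V_Phi)
  show "((\<lambda>\<xi>. optimal_value f h \<Phi> R Q \<Sigma> \<mu> y \<xi> t) has_derivative (\<lambda>v. Vx x t \<bullet> v)) (at x)"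
    using Vx_derivative[OF t] by (simp add: optimal_value_eq_V_Phi[OF t])
qed (use Vt_cont Vx_cont hamilton_jacobi in auto)

end

theorem theorem2:
  fixes f \<Phi> :: "real^'n \<Rightarrow> real^'n" and h :: "real^'n \<Rightarrow> real^'p"
    and \<Lambda> R \<Sigma> :: "real^'n^'n" and Q :: "real^'p^'p" and C :: "real^'n^'p"
    and \<mu> :: "real^'n" and T :: real and y :: "real \<Rightarrow> real^'p"
  assumes "smooth f" and "smooth h"
    and "hyperbolic_equilibrium f 0"
    and "pos_def R" and "pos_def Q" and "pos_def \<Sigma>"
    and "0 < T" and "continuous_on {0..T} y"
    and "principal_eigenfunctions f \<Lambda> \<Phi>"
    and "\<forall>x. h x = C *v \<Phi> x"
  shows "(\<forall>x. \<forall>t\<in>{0..T}. optimal_value f h \<Phi> R Q \<Sigma> \<mu> y x t \<in> costs f h \<Phi> R Q \<Sigma> \<mu> y x t)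
    \<and> HJ_solution f h \<Phi> R Q y T (optimal_value f h \<Phi> R Q \<Sigma> \<mu> y)
    \<and> (\<forall>x. optimal_value f h \<Phi> R Q \<Sigma> \<mu> y x 0 = initial_cost \<Phi> \<Sigma> \<mu> x)
    \<and> (\<exists>P s r. coefficient_solution \<Lambda> C \<Phi> R Q \<Sigma> \<mu> y T P s r)
    \<and> (\<forall>P s r. coefficient_solution \<Lambda> C \<Phi> R Q \<Sigma> \<mu> y T P s r \<longrightarrow>
         (\<forall>t\<in>{0..T}. pos_def (P t)) \<and>
         (\<forall>x. \<forall>t\<in>{0..T}. optimal_value f h \<Phi> R Q \<Sigma> \<mu> y x t = V_Phi \<Phi> P s r x t))"
proof -
  have "C_k 0 f" using \<open>smooth f\<close> unfolding smooth_def by blast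
  then have observer: "koopman_observer f \<Phi> h \<Lambda> R \<Sigma> Q C \<mu> T y P s r"
    if "coefficient_solution \<Lambda> C \<Phi> R Q \<Sigma> \<mu> y T P s r" for P s r
    using assms that by unfold_locales auto
  obtain P s r where coeff: "coefficient_solution \<Lambda> C \<Phi> R Q \<Sigma> \<mu> y T P s r"
    using coefficient_solution_exists assms(4-8) less_imp_le by metis
  interpret koopman_observer f \<Phi> h \<Lambda> R \<Sigma> Q C \<mu> T y P s r by (rule observer[OF coeff])
  have "\<forall>x. \<forall>t\<in>{0..T}. optimal_value f h \<Phi> R Q \<Sigma> \<mu> y x t \<in> costs f h \<Phi> R Q \<Sigma> \<mu> y x t"
    using optimal_value_eq_V_Phi by simp
  moreover have "\<forall>x. optimal_value f h \<Phi> R Q \<Sigma> \<mu> y x 0 = initial_cost \<Phi> \<Sigma> \<mu> x"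
    using optimal_value_eq_V_Phi(1) V_initial \<open>0 < T\<close> by simp
  moreover have "\<exists>P s r. coefficient_solution \<Lambda> C \<Phi> R Q \<Sigma> \<mu> y T P s r" using coeff by blast
  moreover have "(\<forall>t\<in>{0..T}. pos_def (P t)) \<and>
      (\<forall>x. \<forall>t\<in>{0..T}. optimal_value f h \<Phi> R Q \<Sigma> \<mu> y x t = V_Phi \<Phi> P s r x t)"
    if "coefficient_solution \<Lambda> C \<Phi> R Q \<Sigma> \<mu> y T P s r" for P s r
    using koopman_observer.optimal_value_eq_V_Phi(1)[OF observer[OF that]]
      koopman_observer.P_pos_def[OF observer[OF that]] by blast
  ultimately show ?thesis using optimal_value_HJ_solution by blast
qed

end
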